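(* Let $\Gamma$ be a connected, countable, vertex-transitive graph in which every vertex has finite degree. Then $\Gamma$ admits a partite presentation, i.e. there is a partite presentation $P$ with $\Gamma\cong \mathrm{PCay}(P)$.
   Context: Graphs may have loops and multiple edges; each edge has two orientations (directed edges), and a walk traverses directed edges. A partite presentation $P=\langle X\mid U\mid I\mid \phi\mid \mathcal R\rangle$ consists of: a nonempty set $X$ (of vertex classes); disjoint sets $U$, $I$ with $S:=U\cup I$ (the generators); the group $MF_P:=\langle S\mid s^2\ (s\in I)\rangle$; a map $\phi:S\to\mathrm{Sym}(X)$ such that $\phi(s)$ is a fixed-point-free involution for each $s\in I$ and the permutations $\phi(s)$, $s\in S$, generate a subgroup of $\mathrm{Sym}(X)$ acting transitively on $X$; and for each $x\in X$ a set $\mathcal R_x\subseteq MF_P$ of words $s_1\cdots s_n$ ($s_i\in S\cup S^{-1}$, with $\phi(s^{-1}):=\phi(s)^{-1}$) satisfying $\phi(s_n)\circ\cdots\circ\phi(s_1)(x)=x$; $\mathcal R=\{\mathcal R_x: x\in X\}$. The presentation graph $C(P)$ has vertex set $X$; for each $s\in U$ and $x\in X$ it has one edge from $x$ to $\phi(s)(x)$, whose orientation from $x$ to $\phi(s)(x)$ is labelled $s$ and whose reverse orientation is labelled $s^{-1}$; for each $s\in I$ and each pair $\{x,\phi(s)(x)\}$ it has one edge, both of whose orientations are labelled $s$ (so $s^{-1}=s$ for $s\in I$). Thus at every vertex there is exactly one outgoing directed edge with each label in $S\cup S^{-1}$. The presentation complex $\mathcal C(P)$ is obtained from $C(P)$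 by attaching, for every $x\in X$ and every $r=s_1\cdots s_n\in\mathcal R_x$, a 2-cell along the closed walk that starts at $x$ and successively traverses the outgoing directed edges labelled $s_1,\dots,s_n$. The partite Cayley graph $\mathrm{PCay}(P)$ is the 1-skeleton of the universal cover of $\mathcal C(P)$. A graph $\Gamma$ admits a partite presentation if $\Gamma\cong\mathrm{PCay}(P)$ for some partite presentation $P$. *)

theory Defs
  imports Main "HOL-Library.Countable_Set"
begin

section \<open>Graphs with loops and multiple edges (Serre-style: darts with reversal)\<close>

record ('v, 'd) mgraph =
  verts :: "'v set"
  arcs  :: "'d set"          \<comment> \<open>directed edges = orientations of edges\<close>
  tail  :: "'d \<Rightarrow> 'v"
  head  :: "'d \<Rightarrow> 'v"
  rev   :: "'d \<Rightarrow> 'd"     \<comment> \<open>the opposite orientation of the same edge\<close>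

definition multigraph :: "('v, 'd) mgraph \<Rightarrow> bool" where
  "multigraph G \<longleftrightarrow>
     (\<forall>d\<in>arcs G. tail G d \<in> verts G \<and> head G d \<in> verts G \<and>
        rev G d \<in> arcs G \<and> rev G (rev G d) = d \<and> rev G d \<noteq> d \<and>
        tail G (rev G d) = head G d)"

definition graph_iso_map ::
  "('v, 'd) mgraph \<Rightarrow> ('w, 'e) mgraph \<Rightarrow> ('v \<Rightarrow> 'w) \<Rightarrow> ('d \<Rightarrow> 'e) \<Rightarrow> bool" where
  "graph_iso_map G H fv fa \<longleftrightarrow>
     bij_betw fv (verts G) (verts H) \<and> bij_betw fa (arcs G) (arcs H) \<and>
     (\<forall>d\<in>arcs G. tail H (fa d) = fv (tail G d) \<and> head H (fa d) = fv (head G d) \<and>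
                  fa (rev G d) = rev H (fa d))"

definition graph_iso :: "('v, 'd) mgraph \<Rightarrow> ('w, 'e) mgraph \<Rightarrow> bool" where
  "graph_iso G H \<longleftrightarrow> (\<exists>fv fa. graph_iso_map G H fv fa)"

definition vertex_transitive :: "('v, 'd) mgraph \<Rightarrow> bool" where
  "vertex_transitive G \<longleftrightarrow>
     (\<forall>u\<in>verts G. \<forall>v\<in>verts G. \<exists>fv fa. graph_iso_map G G fv fa \<and> fv u = v)"

definition connected_graph :: "('v, 'd) mgraph \<Rightarrow> bool" where
  "connected_graph G \<longleftrightarrow> verts G \<noteq> {} \<and>
     (\<forall>u\<in>verts G. \<forall>v\<in>verts G. (u, v) \<in> {(tail G d, head G d) | d. d \<in> arcs G}\<^sup>*)"

definition locally_finite :: "('v, 'd) mgraph \<Rightarrow> bool" where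
  "locally_finite G \<longleftrightarrow> (\<forall>v\<in>verts G. finite {d \<in> arcs G. tail G d = v})"

section \<open>Partite presentations\<close>

text \<open>A letter is a pair (s, b): (s, False) stands for s and (s, True) for s^-1.
  For s in I we have s^-1 = s, so only (s, False) is used.\<close>

type_synonym letter = "nat \<times> bool"

definition letters :: "nat set \<Rightarrow> nat set \<Rightarrow> letter set" where
  "letters U I = {(s, b). s \<in> U} \<union> {(s, False) | s. s \<in> I}"

definition linv :: "nat set \<Rightarrow> letter \<Rightarrow> letter" where
  "linv I l = (if fst l \<in> I then (fst l, False) else (fst l, \<not> snd l))"

text \<open>phi(s^-1) = phi(s)^-1 (inverse taken as a permutation of X).\<close>
definition act :: "nat set \<Rightarrow> (nat \<Rightarrow> nat \<Rightarrow> nat) \<Rightarrow> letter \<Rightarrow> nat \<Rightarrow> nat" where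
  "act X \<phi> l x = (if snd l then the_inv_into X (\<phi> (fst l)) x else \<phi> (fst l) x)"

text \<open>Endpoint of the walk starting at x and following the word w:
  phi(s_n) o ... o phi(s_1) (x).\<close>
definition walk_end :: "nat set \<Rightarrow> (nat \<Rightarrow> nat \<Rightarrow> nat) \<Rightarrow> nat \<Rightarrow> letter list \<Rightarrow> nat" where
  "walk_end X \<phi> x w = fold (act X \<phi>) w x"

definition partite_pres ::
  "nat set \<Rightarrow> nat set \<Rightarrow> nat set \<Rightarrow> (nat \<Rightarrow> nat \<Rightarrow> nat) \<Rightarrow> (nat \<Rightarrow> letter list set) \<Rightarrow> bool" where
  "partite_pres X U I \<phi> R \<longleftrightarrow>
     X \<noteq> {} \<and> U \<inter> I = {} \<and>
     (\<forall>s\<in>U \<union> I. bij_betw (\<phi> s) X X) \<and>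
     (\<forall>s\<in>I. \<forall>x\<in>X. \<phi> s (\<phi> s x) = x \<and> \<phi> s x \<noteq> x) \<and>
     \<comment> \<open>the group generated by the phi(s) acts transitively on X\<close>
     (\<forall>x\<in>X. \<forall>y\<in>X. \<exists>w\<in>lists (letters U I). walk_end X \<phi> x w = y) \<and>
     (\<forall>x\<in>X. \<forall>r\<in>R x. r \<in> lists (letters U I) \<and> walk_end X \<phi> x r = x)"

text \<open>The presentation graph C(P): the dart (x, l) goes from x to phi(l)(x) and is labelled l.\<close>
definition pres_graph ::
  "nat set \<Rightarrow> nat set \<Rightarrow> nat set \<Rightarrow> (nat \<Rightarrow> nat \<Rightarrow> nat) \<Rightarrow> (nat, nat \<times> letter) mgraph" where
  "pres_graph X U I \<phi> =
     \<lparr> verts = X, arcs = X \<times> letters U I, tail = fst,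
       head = (\<lambda>(x, l). act X \<phi> l x),
       rev = (\<lambda>(x, l). (act X \<phi> l x, linv I l)) \<rparr>"

text \<open>Elementary homotopies of walks (words) in the presentation complex starting at the
  base vertex x0: removal of a backtrack, and removal of the boundary walk of a 2-cell
  (the relator r in R_y read from the vertex y where the walk currently is).\<close>
definition elem_htpy ::
  "nat set \<Rightarrow> nat set \<Rightarrow> nat set \<Rightarrow> (nat \<Rightarrow> nat \<Rightarrow> nat) \<Rightarrow> (nat \<Rightarrow> letter list set) \<Rightarrow> nat
     \<Rightarrow> (letter list \<times> letter list) set" where
  "elem_htpy X U I \<phi> R x0 =
     {(u @ [l, linv I l] @ v, u @ v) | u l v.
        u \<in> lists (letters U I) \<and> l \<in> letters U I \<and> v \<in> lists (letters U I)}
   \<union> {(u @ r @ v, u @ v) | u r v.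
        u \<in> lists (letters U I) \<and> v \<in> lists (letters U I) \<and> r \<in> R (walk_end X \<phi> x0 u)}"

text \<open>Homotopy of walks: equivalence relation generated by elementary homotopies.\<close>
definition htpy ::
  "nat set \<Rightarrow> nat set \<Rightarrow> nat set \<Rightarrow> (nat \<Rightarrow> nat \<Rightarrow> nat) \<Rightarrow> (nat \<Rightarrow> letter list set) \<Rightarrow> nat
     \<Rightarrow> (letter list \<times> letter list) set" where
  "htpy X U I \<phi> R x0 =
     (Id_on (lists (letters U I)) \<union> elem_htpy X U I \<phi> R x0 \<union> (elem_htpy X U I \<phi> R x0)\<inverse>)\<^sup>*"

text \<open>PCay(P): 1-skeleton of the universal cover of the presentation complex, given
  combinatorially. Vertices are homotopy classes of walks from the base vertex x0;
  for each vertex class c and each label l there is a dart (c, l) from c to the class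
  of (w @ [l]) for w in c; its reverse is the dart labelled l^-1 at that class.\<close>
definition pcay ::
  "nat set \<Rightarrow> nat set \<Rightarrow> nat set \<Rightarrow> (nat \<Rightarrow> nat \<Rightarrow> nat) \<Rightarrow> (nat \<Rightarrow> letter list set)
     \<Rightarrow> (letter list set, letter list set \<times> letter) mgraph" where
  "pcay X U I \<phi> R =
     (let x0 = (SOME x. x \<in> X);
          H = htpy X U I \<phi> R x0;
          cls = (\<lambda>w. H `` {w});
          hd = (\<lambda>(c, l). {w'. \<exists>w\<in>c. (w @ [l], w') \<in> H});
          V = lists (letters U I) // H
      in \<lparr> verts = V, arcs = V \<times> letters U I, tail = fst, head = hd,
           rev = (\<lambda>(c, l). (hd (c, l), linv I l)) \<rparr>)"

end

theory Submission
  imports Defs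
begin

text \<open>Take X to be the vertex set of G and let every closed walk be a relator: two walks from the base
  vertex are then homotopic iff they have the same endpoint, so the partite Cayley graph is G itself.
  What remains is to label the darts by permutations and fixed-point-free involutions, i.e. to
  decompose G into 2-factors and, when the degree is odd, one perfect matching. By compactness it is
  enough to do so at finitely many vertices. There, the 2-factors come from Petersen's theorem. For
  the matching, consider a minimal finite set C of vertices not covered by any matching. By
  vertex-transitivity every vertex lies in such a set, and an alternating-path exchange in the spirit
  of Gallai's lemma shows that C is closed under adjacency. Hence C is the whole vertex set, and it
  has odd size, which is impossible for a graph of odd degree.\<close>

section \<open>Colouring bipartite graphs\<close>

text \<open>A generator in \<open>U\<close> amounts to an oriented 2-factor and one in
  \<open>I\<close> to a perfect matching, so degree \<open>n\<close> calls for
  \<open>n div 2\<close> generators of the first kind and \<open>n mod 2\<close> of the second.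
  Regularity yields the 2-factors but not the matching (cubic graphs with bridges may have none);
  beyond regularity itself, this is where transitivity enters. The obstacle is that finite pieces of
  an infinite graph are not regular. Both factor statements are therefore proved relative to a
  finite vertex set \<open>F\<close>: demands are made only at vertices of \<open>F\<close>, edges
  leaving \<open>F\<close> are free at their far end, and the matching that covers \<open>F\<close>
  may use vertices outside it. An uncoverable set \<open>C\<close> of minimal size is finite, so its
  closure under adjacency already rules out infinite graphs; parity is what rules out finite ones.
  The orientation in Petersen's theorem and the edge colouring both reduce to one fact,
  \<open>two_colouring\<close>: two families of disjoint pairs create no odd cycle. It replaces
  Euler tours and Kempe chains.\<close>

definition proper_colouring :: "('a \<Rightarrow> 'b) \<Rightarrow> ('a \<Rightarrow> 'c) \<Rightarrow> 'a set \<Rightarrow> ('a \<Rightarrow> 'k) \<Rightarrow> bool" where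
  "proper_colouring p q T c \<longleftrightarrow>
     (\<forall>x\<in>T. \<forall>y\<in>T. x \<noteq> y \<longrightarrow> p x = p y \<or> q x = q y \<longrightarrow> c x \<noteq> c y)"

lemma proper_colouringD:
  "\<lbrakk>proper_colouring p q T c; x \<in> T; y \<in> T; x \<noteq> y; p x = p y \<or> q x = q y\<rbrakk> \<Longrightarrow> c x \<noteq> c y"
  unfolding proper_colouring_def by blast

lemma proper_colouring_insert:
  assumes c: "proper_colouring p q T c" and "e \<notin> T"
    and b: "\<And>y. \<lbrakk>y \<in> T; p y = p e \<or> q y = q e\<rbrakk> \<Longrightarrow> c y \<noteq> b"
  shows "proper_colouring p q (insert e T) (c(e := b))"
  unfolding proper_colouring_def
proof (intro ballI impI)
  fix x y assume *: "x \<in> insert e T" "y \<in> insert e T" "x \<noteq> y" "p x = p y \<or> q x = q y"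
  consider "x = e" "y \<in> T" | "y = e" "x \<in> T" | "x \<in> T" "y \<in> T" "x \<noteq> e" "y \<noteq> e"
    using * \<open>e \<notin> T\<close> by blast
  then show "(c(e := b)) x \<noteq> (c(e := b)) y"
  proof cases
    case 1
    then have "c y \<noteq> b" using b[of y] * by metis
    then show ?thesis using 1 * by simp
  next
    case 2 then show ?thesis using b[of x] * by simp
  next
    case 3 then show ?thesis using proper_colouringD[OF c _ _ *(3,4)] by simp
  qed
qed

text \<open>Join elements that share a \<open>p\<close>-value or a \<open>q\<close>-value. Each
  element has at most one neighbour of either kind, so the two kinds alternate along paths, cycles
  are even and two colours suffice. The induction contracts such a path instead of describing it,
  which is why \<open>q\<close> has to vary.\<close>

lemma two_colouring:
  fixes p :: "'a \<Rightarrow> 'b" and q :: "'a \<Rightarrow> 'c"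
  assumes "finite T"
    and "\<And>x y z. \<lbrakk>x \<in> T; y \<in> T; z \<in> T; p x = p y; p y = p z\<rbrakk> \<Longrightarrow> x = y \<or> y = z \<or> x = z"
    and "\<And>x y z. \<lbrakk>x \<in> T; y \<in> T; z \<in> T; q x = q y; q y = q z\<rbrakk> \<Longrightarrow> x = y \<or> y = z \<or> x = z"
  shows "\<exists>c :: 'a \<Rightarrow> bool. proper_colouring p q T c"
  using assms
proof (induction "card T" arbitrary: T q rule: less_induct)
  case less
  note p3 = less.prems(2) and q3 = less.prems(3)
  show ?case
  proof (cases "T = {}")
    case True
    then show ?thesis unfolding proper_colouring_def by blast
  next
    case False
    then obtain e where e: "e \<in> T" by blast
    then have T: "insert e (T - {e}) = T" by blast
    have cd: "card (T - {e}) < card T"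
      using e less.prems(1) by (meson card_Diff1_less)
    have "\<exists>c :: 'a \<Rightarrow> bool. proper_colouring p q (T - {e}) c"
      by (rule less.hyps[OF cd]) (use less.prems(1) p3 q3 in \<open>auto\<close>)
    then obtain c :: "'a \<Rightarrow> bool" where c: "proper_colouring p q (T - {e}) c" by blast
    have extend: ?thesis if "\<And>y. \<lbrakk>y \<in> T - {e}; p y = p e \<or> q y = q e\<rbrakk> \<Longrightarrow> c y \<noteq> b" for b
    proof -
      have "proper_colouring p q (insert e (T - {e})) (c(e := b))"
        by (rule proper_colouring_insert[OF c _ that]) simp
      then show ?thesis unfolding T by (intro exI[of _ "c(e := b)"])
    qed
    have pe: "x = y" if "x \<in> T - {e}" "p x = p e" "y \<in> T - {e}" "p y = p e" for x y
      using p3[of x y e] that e by auto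
    have qe: "x = y" if "x \<in> T - {e}" "q x = q e" "y \<in> T - {e}" "q y = q e" for x y
      using q3[of x y e] that e by auto
    consider (np) "\<And>a. a \<in> T - {e} \<Longrightarrow> p a \<noteq> p e" | (nq) "\<And>a. a \<in> T - {e} \<Longrightarrow> q a \<noteq> q e"
      | (both) a b where "a \<in> T - {e}" "p a = p e" "b \<in> T - {e}" "q b = q e" by blast
    then show ?thesis
    proof cases
      case np
      show ?thesis
      proof (cases "\<exists>b\<in>T - {e}. q b = q e")
        case True
        then obtain b where b: "b \<in> T - {e}" "q b = q e" by blast
        show ?thesis
        proof (rule extend[of "\<not> c b"])
          fix y assume "y \<in> T - {e}" "p y = p e \<or> q y = q e"
          then have "y = b" using np qe b by blast
          then show "c y \<noteq> (\<not> c b)" by blast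
        qed
      qed (use np extend in blast)
    next
      case nq
      show ?thesis
      proof (cases "\<exists>b\<in>T - {e}. p b = p e")
        case True
        then obtain b where b: "b \<in> T - {e}" "p b = p e" by blast
        show ?thesis
        proof (rule extend[of "\<not> c b"])
          fix y assume "y \<in> T - {e}" "p y = p e \<or> q y = q e"
          then have "y = b" using nq pe b by blast
          then show "c y \<noteq> (\<not> c b)" by blast
        qed
      qed (use nq extend in blast)
    next
      case both
      \<comment> \<open>Deleting e and a merges what is left of their q-classes, at most one element of each.\<close>
      define q' where "q' z = (if q z = q a then q e else q z)" for z
      let ?T = "T - {e, a}"
      have ae: "a \<noteq> e" using both by blast
      have Ta: "insert a ?T = T - {e}" using both ae by blast
      have "card ?T \<le> card (T - {e})" using less.prems(1) by (intro card_mono) auto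
      then have cd': "card ?T < card T" using cd by simp
      have q3': "x = y \<or> y = z \<or> x = z" if "x \<in> ?T" "y \<in> ?T" "z \<in> ?T" "q' x = q' y" "q' y = q' z" for x y z
      proof -
        have qa: "u = w" if "u \<in> ?T" "w \<in> ?T" "q u = q a" "q w = q a" for u w
          using q3[of u w a] that both by auto
        show ?thesis
        proof (cases "q' x = q e")
          case True
          then have "q u = q a \<or> q u = q e" if "u \<in> {x, y, z}" for u
            using that \<open>q' x = q' y\<close> \<open>q' y = q' z\<close> by (auto simp: q'_def split: if_splits)
          then have "q x = q a \<or> q x = q e" "q y = q a \<or> q y = q e" "q z = q a \<or> q z = q e" by blast+
          moreover have "x \<in> T - {e}" "y \<in> T - {e}" "z \<in> T - {e}" using that by blast+
          ultimately show ?thesis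
            using qa that(1-3) qe by metis
        next
          case False
          then have "q x = q y" "q y = q z"
            using that(4,5) by (auto simp: q'_def split: if_splits)
          then show ?thesis using q3 that(1-3) by blast
        qed
      qed
      have "\<exists>c :: 'a \<Rightarrow> bool. proper_colouring p q' ?T c"
        by (rule less.hyps[OF cd' _ _ q3']) (use less.prems(1) p3 in \<open>auto\<close>)
      then obtain c :: "'a \<Rightarrow> bool" where c: "proper_colouring p q' ?T c" by blast
      then have c': "proper_colouring p q ?T c"
        unfolding proper_colouring_def q'_def by metis
      have pa: "p x \<noteq> p a" if "x \<in> ?T" for x
        using pe[of x a] both that by auto
      \<comment> \<open>\<open>a\<close> will receive \<open>\<beta>\<close> and \<open>e\<close>
        the other colour. If \<open>a\<close> and \<open>e\<close> share a \<open>q\<close>-class,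
        nothing else lies in it and any \<open>\<beta>\<close> will do. Otherwise take the colour of
        the \<open>q\<close>-partner \<open>b\<close> of \<open>e\<close>: the merged class makes
        the \<open>q\<close>-partner of \<open>a\<close>, if there is one, differ from
        \<open>b\<close>.\<close>
      obtain \<beta> where \<beta>: "\<And>x. \<lbrakk>x \<in> ?T; q x = q a\<rbrakk> \<Longrightarrow> c x \<noteq> \<beta>"
        "\<And>x. \<lbrakk>x \<in> ?T; q x = q e\<rbrakk> \<Longrightarrow> c x \<noteq> (\<not> \<beta>)"
      proof (cases "q a = q e")
        case True
        then have "x = a" if "x \<in> ?T" "q x = q e" for x
          using qe[of x a] both that by auto
        then show ?thesis using that True by fastforce
      next
        case False
        then have "b \<noteq> a" using both by auto
        then have bT: "b \<in> ?T" using both by blast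
        show ?thesis
        proof (rule that[of "c b"])
          fix x assume x: "x \<in> ?T" "q x = q a"
          then have "x \<noteq> b" using both False by auto
          moreover have "q' x = q' b" using x both by (simp add: q'_def)
          ultimately show "c x \<noteq> c b" using proper_colouringD[OF c x(1) bT] by blast
        next
          fix x assume x: "x \<in> ?T" "q x = q e"
          then have "x = b" using qe[of x b] both by blast
          then show "c x \<noteq> (\<not> c b)" by simp
        qed
      qed
      have ca: "proper_colouring p q (T - {e}) (c(a := \<beta>))"
        using proper_colouring_insert[OF c', of a \<beta>] pa \<beta> unfolding Ta by blast
      have "proper_colouring p q (insert e (T - {e})) (c(a := \<beta>, e := \<not> \<beta>))"
      proof (rule proper_colouring_insert[OF ca])
        fix y assume y: "y \<in> T - {e}" "p y = p e \<or> q y = q e"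
        show "(c(a := \<beta>)) y \<noteq> (\<not> \<beta>)"
        proof (cases "y = a")
          case False
          then have "q y = q e" "y \<in> ?T" using y pa[of y] both by auto
          then show ?thesis using \<beta>(2)[of y] False by simp
        qed simp
      qed simp
      then show ?thesis unfolding T by blast
    qed
  qed
qed

text \<open>Koenig's edge colouring theorem: \<open>T\<close> is the edge set of a bipartite
  multigraph, and \<open>p\<close>, \<open>q\<close> give the ends on the two sides. If the colours
  picked as free at the two ends of a new edge differ, the whole subgraph in these two colours is
  recoloured at once, in place of a single Kempe chain.\<close>

lemma bipartite_edge_colouring:
  fixes p :: "'a \<Rightarrow> 'b" and q :: "'a \<Rightarrow> 'c"
  assumes "finite T" and "\<And>v. card {x \<in> T. p x = v} \<le> k" and "\<And>v. card {x \<in> T. q x = v} \<le> k"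
  shows "\<exists>c. c ` T \<subseteq> {..<k} \<and> proper_colouring p q T c"
  using assms
proof (induction T)
  case empty
  then show ?case by (auto simp: proper_colouring_def)
next
  case (insert e T)
  have mono: "card {x \<in> T. P x} \<le> card {x \<in> insert e T. P x}" for P
    using insert.hyps by (intro card_mono) auto
  obtain c where ck: "c ` T \<subseteq> {..<k}" and c: "proper_colouring p q T c"
    using insert.IH[OF order_trans[OF mono insert.prems(1)] order_trans[OF mono insert.prems(2)]]
    by blast
  have free: "\<exists>\<alpha><k. \<forall>x\<in>T. P x \<longrightarrow> c x \<noteq> \<alpha>" if "card {x \<in> insert e T. P x} \<le> k" "P e" for P
  proof -
    have "{x \<in> insert e T. P x} = insert e {x \<in> T. P x}" using that by auto
    then have "card {x \<in> T. P x} < k" using that insert.hyps by simp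
    then have "card (c ` {x \<in> T. P x}) < card {..<k}"
      using card_image_le[of "{x \<in> T. P x}" c] insert.hyps by simp
    then have "\<not> {..<k} \<subseteq> c ` {x \<in> T. P x}"
      using insert.hyps card_mono[of "c ` {x \<in> T. P x}" "{..<k}"] by auto
    then show ?thesis by blast
  qed
  obtain \<alpha> where \<alpha>: "\<alpha> < k" "\<And>x. \<lbrakk>x \<in> T; p x = p e\<rbrakk> \<Longrightarrow> c x \<noteq> \<alpha>"
    using free[of "\<lambda>x. p x = p e"] insert.prems(1) by blast
  obtain \<beta> where \<beta>: "\<beta> < k" "\<And>x. \<lbrakk>x \<in> T; q x = q e\<rbrakk> \<Longrightarrow> c x \<noteq> \<beta>"
    using free[of "\<lambda>x. q x = q e"] insert.prems(2) by blast
  show ?case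
  proof (cases "\<alpha> = \<beta>")
    case True
    then have "proper_colouring p q (insert e T) (c(e := \<alpha>))"
      using proper_colouring_insert[OF c insert.hyps(2), of \<alpha>] \<alpha> \<beta> by blast
    moreover have "(c(e := \<alpha>)) ` insert e T \<subseteq> {..<k}" using ck \<alpha> by auto
    ultimately show ?thesis by blast
  next
    case False
    \<comment> \<open>The edges with the two missing colours, together with e, have degree at most 2: recolour them.\<close>
    define W where "W = insert e {x \<in> T. c x = \<alpha> \<or> c x = \<beta>}"
    have WT: "x \<in> T" "c x = \<alpha> \<or> c x = \<beta>" if "x \<in> W" "x \<noteq> e" for x
      using that by (auto simp: W_def)
    \<comment> \<open>Applied to three edges of \<open>W\<close> at a common vertex:
      \<open>inj\<close> holds because \<open>c\<close> is proper there, and \<gamma> is the colour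
      missing there if \<open>e\<close> is among them. Besides \<open>e\<close>, only one colour is
      left for two edges; without \<open>e\<close>, there are two colours for three edges.\<close>
    have deg2: "x = y \<or> y = z \<or> x = z"
      if W: "{x, y, z} \<subseteq> W" and inj: "inj_on c ({x, y, z} - {e})"
        and \<gamma>: "e \<in> {x, y, z} \<Longrightarrow> \<gamma> \<notin> c ` ({x, y, z} - {e})" "\<gamma> \<in> {\<alpha>, \<beta>}" for x y z \<gamma>
    proof (rule ccontr)
      assume "\<not> ?thesis"
      then have 3: "card {x, y, z} = 3" by auto
      have sub: "c ` ({x, y, z} - {e}) \<subseteq> {\<alpha>, \<beta>}" using W WT by blast
      show False
      proof (cases "e \<in> {x, y, z}")
        case True
        then have "c ` ({x, y, z} - {e}) \<subseteq> {\<alpha>, \<beta>} - {\<gamma>}" using sub \<gamma> by blast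
        then have "card (c ` ({x, y, z} - {e})) \<le> card ({\<alpha>, \<beta>} - {\<gamma>})" by (intro card_mono) auto
        also have "\<dots> = 1" using \<gamma>(2) False by auto
        finally have "card ({x, y, z} - {e}) \<le> 1" using card_image[OF inj] by simp
        moreover have "card ({x, y, z} - {e}) = 2" using 3 True by (simp add: card_Diff_singleton)
        ultimately show False by simp
      next
        case False
        have "card (c ` ({x, y, z} - {e})) \<le> card {\<alpha>, \<beta>}" using sub by (intro card_mono) auto
        also have "\<dots> \<le> 2" by (simp add: card_insert_if)
        finally have "card ({x, y, z} - {e}) \<le> 2" using card_image[OF inj] by simp
        then show False using 3 False by simp
      qed
    qed
    have "finite W" using insert.hyps by (simp add: W_def)
    moreover have "x = y \<or> y = z \<or> x = z"
      if xyz: "x \<in> W" "y \<in> W" "z \<in> W" and eq: "p x = p y" "p y = p z" for x y z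
    proof (rule deg2[of x y z \<alpha>])
      show "inj_on c ({x, y, z} - {e})"
      proof (rule inj_onI)
        fix u w assume *: "u \<in> {x, y, z} - {e}" "w \<in> {x, y, z} - {e}" "c u = c w"
        then have "p u = p w" "u \<in> T" "w \<in> T" using eq xyz WT by auto
        then show "u = w" using proper_colouringD[OF c] *(3) by blast
      qed
      show "\<alpha> \<notin> c ` ({x, y, z} - {e})" if "e \<in> {x, y, z}"
      proof
        assume "\<alpha> \<in> c ` ({x, y, z} - {e})"
        then obtain u where u: "u \<in> {x, y, z} - {e}" "c u = \<alpha>" by blast
        then have "p u = p e" "u \<in> T" using that eq xyz WT by auto
        then show False using \<alpha>(2) u(2) by blast
      qed
    qed (use xyz in auto)
    moreover have "x = y \<or> y = z \<or> x = z"
      if xyz: "x \<in> W" "y \<in> W" "z \<in> W" and eq: "q x = q y" "q y = q z" for x y z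
    proof (rule deg2[of x y z \<beta>])
      show "inj_on c ({x, y, z} - {e})"
      proof (rule inj_onI)
        fix u w assume *: "u \<in> {x, y, z} - {e}" "w \<in> {x, y, z} - {e}" "c u = c w"
        then have "q u = q w" "u \<in> T" "w \<in> T" using eq xyz WT by auto
        then show "u = w" using proper_colouringD[OF c] *(3) by blast
      qed
      show "\<beta> \<notin> c ` ({x, y, z} - {e})" if "e \<in> {x, y, z}"
      proof
        assume "\<beta> \<in> c ` ({x, y, z} - {e})"
        then obtain u where u: "u \<in> {x, y, z} - {e}" "c u = \<beta>" by blast
        then have "q u = q e" "u \<in> T" using that eq xyz WT by auto
        then show False using \<beta>(2) u(2) by blast
      qed
    qed (use xyz in auto)
    ultimately have "\<exists>d :: 'a \<Rightarrow> bool. proper_colouring p q W d" by (rule two_colouring)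
    then obtain d :: "'a \<Rightarrow> bool" where d: "proper_colouring p q W d" by blast
    define c' where "c' x = (if x \<in> W then if d x then \<alpha> else \<beta> else c x)" for x
    have out: "x \<in> T" "c x \<notin> {\<alpha>, \<beta>}" if "x \<in> insert e T" "x \<notin> W" for x
      using that by (auto simp: W_def)
    have in_W: "c' x \<in> {\<alpha>, \<beta>}" if "x \<in> W" for x using that by (simp add: c'_def)
    have not_W: "c' x = c x" if "x \<notin> W" for x using that by (simp add: c'_def)
    have "c' x < k" if "x \<in> insert e T" for x
    proof (cases "x \<in> W")
      case True then show ?thesis using in_W \<alpha>(1) \<beta>(1) by blast
    next
      case False then show ?thesis using out(1) that ck not_W by fastforce
    qed
    moreover have "proper_colouring p q (insert e T) c'"
      unfolding proper_colouring_def
    proof (intro ballI impI)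
      fix x y assume *: "x \<in> insert e T" "y \<in> insert e T" "x \<noteq> y" "p x = p y \<or> q x = q y"
      show "c' x \<noteq> c' y"
      proof (cases "x \<in> W"; cases "y \<in> W")
        assume "x \<in> W" "y \<in> W"
        then show ?thesis using proper_colouringD[OF d _ _ *(3,4)] False by (auto simp: c'_def)
      next
        assume "x \<in> W" "y \<notin> W"
        then show ?thesis using in_W out(2) *(2) not_W by metis
      next
        assume "x \<notin> W" "y \<in> W"
        then show ?thesis using in_W out(2) *(1) not_W by metis
      next
        assume "x \<notin> W" "y \<notin> W"
        then show ?thesis using proper_colouringD[OF c out(1) out(1)] * not_W by metis
      qed
    qed
    ultimately show ?thesis by blast
  qed
qed

section \<open>Vertex sets of finite matchings\<close>

text \<open>Records only which vertices a finite matching covers and forgets its edges, so that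
  alternating paths never have to be represented as objects.\<close>

inductive matchable :: "('a \<Rightarrow> 'a \<Rightarrow> bool) \<Rightarrow> 'a set \<Rightarrow> bool" for E where
  empty: "matchable E {}"
| add: "\<lbrakk>matchable E A; E a b; a \<noteq> b; a \<notin> A; b \<notin> A\<rbrakk> \<Longrightarrow> matchable E (insert a (insert b A))"

lemma matchable_finite: "matchable E A \<Longrightarrow> finite A"
  by (induction rule: matchable.induct) auto

lemma matchable_even: "matchable E A \<Longrightarrow> even (card A)"
proof (induction rule: matchable.induct)
  case (add A a b)
  then show ?case using matchable_finite[of E A] by simp
qed simp

text \<open>Edges of a matching may be added in any order, so the edge at \<open>v\<close> can be
  taken as the last one; this supplies the next step of an alternating path.\<close>

lemma matchable_remove:
  assumes "matchable E A" "symp E" "v \<in> A"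
  obtains a where "a \<in> A" "a \<noteq> v" "E v a" "matchable E (A - {v, a})"
proof -
  from assms have "\<exists>a\<in>A. a \<noteq> v \<and> E v a \<and> matchable E (A - {v, a})"
  proof (induction rule: matchable.induct)
    case (add A a b)
    show ?case
    proof (cases "v \<in> A")
      case True
      then obtain c where c: "c \<in> A" "c \<noteq> v" "E v c" "matchable E (A - {v, c})"
        using add by blast
      have "insert a (insert b A) - {v, c} = insert a (insert b (A - {v, c}))"
        using True c add.hyps by auto
      then show ?thesis using c add.hyps matchable.add[OF c(4), of a b] by (intro bexI[of _ c]) simp_all
    next
      case False
      have A: "insert a (insert b A) - {a, b} = A" "insert a (insert b A) - {b, a} = A"
        using add.hyps by auto
      have "E b a" using add by (meson sympD)
      moreover consider "v = a" | "v = b" using False add.prems by blast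
      ultimately show ?thesis
        using A add.hyps by cases (metis insertCI)+
    qed
  qed simp
  then show ?thesis using that by blast
qed

lemma matchable_image:
  assumes "matchable E A" "inj_on g V" "A \<subseteq> V"
    and "\<And>x y. \<lbrakk>x \<in> V; y \<in> V; E x y\<rbrakk> \<Longrightarrow> E (g x) (g y)"
  shows "matchable E (g ` A)"
  using assms
proof (induction rule: matchable.induct)
  case (add A a b)
  then have "a \<in> V" "b \<in> V" "A \<subseteq> V" by auto
  then have "g a \<noteq> g b" "g a \<notin> g ` A" "g b \<notin> g ` A" "E (g a) (g b)"
    using add.hyps add.prems inj_on_image_mem_iff[OF add.prems(1)] by (auto simp: inj_on_def)
  then show ?case using add.IH add.prems matchable.add[of E "g ` A" "g a" "g b"] by simp
qed (simp add: matchable.empty)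

text \<open>The endpoints of an alternating path, tracked through the vertex sets of the two matchings only.\<close>

lemma matchable_exchange:
  assumes "symp E" "matchable E A" "matchable E B" "v \<in> A" "v \<notin> B"
  shows "(\<exists>w\<in>A - B. w \<noteq> v \<and> matchable E (A - {v, w}) \<and> matchable E (insert v (insert w B))) \<or>
         (\<exists>w\<in>B - A. matchable E (insert w (A - {v})) \<and> matchable E (insert v (B - {w})))"
  using assms
proof (induction "card A" arbitrary: A B v rule: less_induct)
  case less
  note sym = less.prems(1) and mA = less.prems(2) and mB = less.prems(3)
  obtain a where a: "a \<in> A" "a \<noteq> v" "E v a" "matchable E (A - {v, a})"
    using matchable_remove less.prems by metis
  show ?case
  proof (cases "a \<in> B")
    case False
    then show ?thesis using a less.prems matchable.add[OF mB, of v a] by blast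
  next
    case True
    obtain b where b: "b \<in> B" "b \<noteq> a" "E a b" "matchable E (B - {a, b})"
      using matchable_remove[OF mB sym True] by metis
    have bv: "b \<noteq> v" using b less.prems by auto
    let ?A = "A - {v, a}" and ?B = "B - {a, b}"
    have cA: "card ?A < card A"
      using a less.prems(4) matchable_finite[OF mA] by (intro psubset_card_mono) auto
    show ?thesis
    proof (cases "b \<in> A")
      case False
      have "insert b (A - {v}) = insert a (insert b ?A)" "insert v (B - {b}) = insert v (insert a ?B)"
        using a b True by auto
      then show ?thesis
        using matchable.add[OF a(4), of a b] matchable.add[OF b(4), of v a] a b less.prems bv False
        by (metis (no_types, lifting) Diff_iff insertCI)
    next
      \<comment> \<open>The path starts \<open>v\<close>, \<open>a\<close>, \<open>b\<close>, and
        the induction continues it from \<open>b\<close> in the two smaller matchings. Afterwards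
        the two edges change sides: \<open>a b\<close> is put into the first matching and
        \<open>v a\<close> into the second.\<close>
      case bA: True
      have "b \<in> ?A" "b \<notin> ?B" using bA b bv by auto
      then consider
        (1) w where "w \<in> ?A - ?B" "w \<noteq> b" "matchable E (?A - {b, w})" "matchable E (insert b (insert w ?B))"
      | (2) w where "w \<in> ?B - ?A" "matchable E (insert w (?A - {b}))" "matchable E (insert b (?B - {w}))"
        using less.hyps[OF cA sym a(4) b(4), of b] by blast
      then show ?thesis
      proof cases
        case 1
        have "A - {v, w} = insert a (insert b (?A - {b, w}))"
          using 1 a b bA bv by auto
        moreover have "insert v (insert w B) = insert v (insert a (insert b (insert w ?B)))"
          using b True by auto
        moreover have "matchable E (insert a (insert b (?A - {b, w})))"
          using matchable.add[OF 1(3), of a b] b by auto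
        moreover have "matchable E (insert v (insert a (insert b (insert w ?B))))"
          by (rule matchable.add[OF 1(4)]) (use a b 1 bv less.prems in auto)
        ultimately show ?thesis using 1 b by (metis (no_types, lifting) DiffE DiffI insertCI insertE)
      next
        case 2
        have wv: "w \<noteq> v" using 2 less.prems by auto
        have "insert w (A - {v}) = insert a (insert b (insert w (?A - {b})))"
          using 2 a b bA bv by auto
        moreover have "insert v (B - {w}) = insert v (insert a (insert b (?B - {w})))"
          using b True 2 by auto
        moreover have "matchable E (insert a (insert b (insert w (?A - {b}))))"
          by (rule matchable.add[OF 2(2)]) (use b 2 in auto)
        moreover have "matchable E (insert v (insert a (insert b (?B - {w}))))"
          by (rule matchable.add[OF 2(3)]) (use a b 2 bv less.prems in auto)
        moreover have "w \<in> B - A" using 2 wv by auto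
        ultimately show ?thesis by metis
      qed
    qed
  qed
qed

text \<open>A circuit of the matching matroid, where a set is independent if some finite matching
  covers it. Such a set is nonempty and finite.\<close>

definition matching_circuit :: "('a \<Rightarrow> 'a \<Rightarrow> bool) \<Rightarrow> 'a set \<Rightarrow> bool" where
  "matching_circuit E C \<longleftrightarrow> (\<nexists>A. matchable E A \<and> C \<subseteq> A) \<and>
     (\<forall>u\<in>C. \<exists>A. matchable E A \<and> C - {u} \<subseteq> A)"

lemma matching_circuit_uncoverable: "\<lbrakk>matching_circuit E C; matchable E A\<rbrakk> \<Longrightarrow> \<not> C \<subseteq> A"
  unfolding matching_circuit_def by blast

lemma matching_circuit_cover_minus:
  assumes "matching_circuit E C" "u \<in> C"
  obtains A where "matchable E A" "C - {u} \<subseteq> A"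
  using assms unfolding matching_circuit_def by blast

lemma matching_circuit_exists:
  assumes "finite F" "\<nexists>A. matchable E A \<and> F \<subseteq> A"
  obtains C where "C \<subseteq> F" "matching_circuit E C"
proof -
  let ?K = "{C. C \<subseteq> F \<and> (\<nexists>A. matchable E A \<and> C \<subseteq> A)}"
  have "finite ?K" using assms(1) by simp
  moreover have "F \<in> ?K" using assms(2) by simp
  ultimately obtain C where "C \<in> ?K" and min0: "\<forall>C'\<in>?K. C' \<subseteq> C \<longrightarrow> C = C'"
    using finite_has_minimal[of ?K] by blast
  then have C: "C \<subseteq> F" "\<nexists>A. matchable E A \<and> C \<subseteq> A" by blast+
  have min: "C' = C" if "C' \<subseteq> F" "\<nexists>A. matchable E A \<and> C' \<subseteq> A" "C' \<subseteq> C" for C'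
    using min0 that by blast
  have "\<exists>A. matchable E A \<and> C - {u} \<subseteq> A" if "u \<in> C" for u
    using min[of "C - {u}"] that C(1) by blast
  then show ?thesis using that C unfolding matching_circuit_def by blast
qed

text \<open>Suppose \<open>v\<close> is outside \<open>C\<close>. Every matching that covers
  \<open>C - {u}\<close> then covers \<open>v\<close>, for otherwise the edge from \<open>u\<close>
  to \<open>v\<close> could be added to cover \<open>C\<close>. Exchanging along the alternating
  path from \<open>v\<close> either adds \<open>v\<close> to a matching that covers
  \<open>D - {v}\<close>, hence covers \<open>D\<close>, or frees \<open>v\<close> while
  \<open>C - {u}\<close> stays covered. Both are impossible.\<close>

lemma matching_circuit_closed:
  assumes "symp E" "matching_circuit E C" "matching_circuit E D"
    and "u \<in> C" "E u v" "u \<noteq> v" "v \<in> D"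
  shows "v \<in> C"
proof (rule ccontr)
  assume vC: "v \<notin> C"
  obtain A where A: "matchable E A" "C - {u} \<subseteq> A"
    using matching_circuit_cover_minus assms(2,4) by metis
  obtain B where B: "matchable E B" "D - {v} \<subseteq> B"
    using matching_circuit_cover_minus assms(3,7) by metis
  note nC = matching_circuit_uncoverable[OF assms(2)] and nD = matching_circuit_uncoverable[OF assms(3)]
  have covers: "v \<in> A'" if "matchable E A'" "C - {u} \<subseteq> A'" for A'
  proof (rule ccontr)
    assume "v \<notin> A'"
    moreover have "u \<notin> A'" using nC that by blast
    ultimately have "matchable E (insert u (insert v A'))"
      using matchable.add that assms by metis
    then show False using nC that by blast
  qed
  have vB: "v \<notin> B" using nD B by blast
  consider w where "matchable E (insert v (insert w B))" | w where "w \<in> B - A" "matchable E (insert w (A - {v}))"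
    using matchable_exchange[OF assms(1) A(1) B(1) covers[OF A] vB] by blast
  then show False
  proof cases
    case 1
    then show False using nD B by blast
  next
    case 2
    then have "v \<in> insert w (A - {v})" by (intro covers) (use A vC in auto)
    then show False using 2 vB by auto
  qed
qed

section \<open>Compactness and matchings in vertex-transitive graphs\<close>

text \<open>Diagonal argument with nested infinite index sets, each fixing the value of
  \<open>g\<close> at one more point of \<open>A\<close>. Infinitely many agreeing indices are kept,
  not just one, so that an index can later be chosen as large as required.\<close>

lemma countable_compactness:
  fixes g :: "nat \<Rightarrow> 'a \<Rightarrow> 'b"
  assumes "countable A" "finite L" and gL: "\<And>n a. a \<in> A \<Longrightarrow> g n a \<in> L"
  shows "\<exists>f. \<forall>B. finite B \<longrightarrow> B \<subseteq> A \<longrightarrow> infinite {n. \<forall>a\<in>B. g n a = f a}"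
proof (cases "A = {}")
  case True
  then show ?thesis by simp
next
  case False
  define a where "a = from_nat_into A"
  have aA: "a i \<in> A" for i unfolding a_def using False by (rule from_nat_into)
  have "\<exists>S. \<forall>n. infinite (S n) \<and>
      (S (Suc n) \<subseteq> S n \<and> (\<forall>i\<in>S (Suc n). \<forall>j\<in>S (Suc n). g i (a n) = g j (a n)))"
  proof (rule dependent_nat_choice)
    show "\<exists>S :: nat set. infinite S" using infinite_UNIV_nat by blast
    fix S :: "nat set" and n assume "infinite S"
    moreover have "finite ((\<lambda>i. g i (a n)) ` S)"
      using gL[OF aA] by (intro finite_subset[OF _ \<open>finite L\<close>]) auto
    ultimately obtain i where "infinite {j \<in> S. g j (a n) = g i (a n)}"
      using pigeonhole_infinite[of S "\<lambda>i. g i (a n)"] by auto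
    then show "\<exists>S'. infinite S' \<and> (S' \<subseteq> S \<and> (\<forall>i\<in>S'. \<forall>j\<in>S'. g i (a n) = g j (a n)))"
      by (intro exI[of _ "{j \<in> S. g j (a n) = g i (a n)}"]) auto
  qed
  then obtain S where inf: "\<And>n. infinite (S n)" and dec: "\<And>n. S (Suc n) \<subseteq> S n"
    and const: "\<And>n i j. \<lbrakk>i \<in> S (Suc n); j \<in> S (Suc n)\<rbrakk> \<Longrightarrow> g i (a n) = g j (a n)" by metis
  have anti: "S n \<subseteq> S m" if "m \<le> n" for m n
    using lift_Suc_antimono_le[of S, OF dec that] .
  define f where "f x = g (SOME i. i \<in> S (Suc (to_nat_on A x))) x" for x
  show ?thesis
  proof (intro exI[of _ f] allI impI)
    fix B assume B: "finite B" "B \<subseteq> A"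
    define N where "N = Max (insert 0 ((\<lambda>x. Suc (to_nat_on A x)) ` B))"
    have "g i x = f x" if "i \<in> S N" "x \<in> B" for i x
    proof -
      have x: "a (to_nat_on A x) = x" using that B \<open>countable A\<close> unfolding a_def by auto
      have "Suc (to_nat_on A x) \<le> N" unfolding N_def using B that by (intro Max_ge) auto
      then have "i \<in> S (Suc (to_nat_on A x))" using anti that by blast
      moreover have "(SOME i. i \<in> S (Suc (to_nat_on A x))) \<in> S (Suc (to_nat_on A x))"
        using inf by (metis finite.emptyI ex_in_conv someI_ex)
      ultimately show ?thesis using const[of i "to_nat_on A x"] unfolding f_def x by blast
    qed
    then have "S N \<subseteq> {n. \<forall>a\<in>B. g n a = f a}" by blast
    then show "infinite {n. \<forall>a\<in>B. g n a = f a}" using inf finite_subset by blast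
  qed
qed

lemma even_card_fixpoint_free_involution:
  assumes "finite D" "\<And>d. d \<in> D \<Longrightarrow> r d \<in> D \<and> r (r d) = d \<and> r d \<noteq> d"
  shows "even (card D)"
  using assms
proof (induction "card D" arbitrary: D rule: less_induct)
  case less
  show ?case
  proof (cases "D = {}")
    case False
    then obtain d where d: "d \<in> D" by blast
    let ?D = "D - {d, r d}"
    have rd: "{d, r d} \<subseteq> D" "card {d, r d} = 2" using less.prems(2)[OF d] d by auto
    have c: "card ?D = card D - 2"
      using card_Diff_subset[OF _ rd(1)] rd(2) by simp
    have c2: "card D \<ge> 2" using card_mono[OF less.prems(1) rd(1)] rd(2) by simp
    have "r x \<in> ?D \<and> r (r x) = x \<and> r x \<noteq> x" if "x \<in> ?D" for x
      using less.prems(2)[of x] less.prems(2)[OF d] that by auto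
    then have "even (card ?D)"
      using less.hyps[of ?D] less.prems(1) c c2 by simp
    then show ?thesis using c c2 by simp
  qed simp
qed

lemma matching_circuit_image:
  assumes bij: "bij_betw g V V" and EV: "\<And>x y. E x y \<Longrightarrow> x \<in> V \<and> y \<in> V"
    and hom: "\<And>x y. \<lbrakk>x \<in> V; y \<in> V\<rbrakk> \<Longrightarrow> E (g x) (g y) \<longleftrightarrow> E x y"
    and C: "matching_circuit E C" "C \<subseteq> V"
  shows "matching_circuit E (g ` C)"
proof -
  have AV: "A \<subseteq> V" if "matchable E A" for A
    using that by induction (use EV in auto)
  let ?h = "the_inv_into V g"
  have inj: "inj_on g V" using bij by (simp add: bij_betw_def)
  have hbij: "bij_betw ?h V V" using bij by (rule bij_betw_the_inv_into)
  have gh: "g (?h x) = x" "?h x \<in> V" if "x \<in> V" for x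
    using that bij f_the_inv_into_f_bij_betw bij_betwE[OF hbij] by metis+
  have hom': "E (?h x) (?h y)" if "x \<in> V" "y \<in> V" "E x y" for x y
    using hom[of "?h x" "?h y"] gh that by metis
  have "\<not> g ` C \<subseteq> A" if A: "matchable E A" for A
  proof
    assume "g ` C \<subseteq> A"
    then have "?h (g x) \<in> ?h ` A" if "x \<in> C" for x using that by blast
    then have "C \<subseteq> ?h ` A"
      using C(2) the_inv_into_f_f[OF inj] by (metis subset_iff)
    moreover have "matchable E (?h ` A)"
      by (rule matchable_image[OF A bij_betw_imp_inj_on[OF hbij] AV[OF A] hom'])
    ultimately show False using matching_circuit_uncoverable[OF C(1)] by metis
  qed
  moreover have "\<exists>A. matchable E A \<and> g ` C - {g u} \<subseteq> A" if u: "u \<in> C" for u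
  proof -
    obtain A where A: "matchable E A" "C - {u} \<subseteq> A"
      by (rule matching_circuit_cover_minus[OF C(1) u])
    have "matchable E (g ` A)"
      by (rule matchable_image[OF A(1) inj AV[OF A(1)]]) (simp add: hom)
    moreover have "g ` C - {g u} \<subseteq> g ` A" using A(2) by blast
    ultimately show ?thesis by metis
  qed
  ultimately show ?thesis unfolding matching_circuit_def by simp
qed

section \<open>Adjacency, matchings as sets of darts, and automorphisms\<close>

abbreviation darts_at :: "('v, 'd) mgraph \<Rightarrow> 'v \<Rightarrow> 'd set" where
  "darts_at G v \<equiv> {d \<in> arcs G. tail G d = v}"

definition adj :: "('v, 'd) mgraph \<Rightarrow> 'v \<Rightarrow> 'v \<Rightarrow> bool" where
  "adj G u v \<longleftrightarrow> (\<exists>d\<in>arcs G. tail G d = u \<and> head G d = v)"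

lemma multigraphD:
  assumes "multigraph G" "d \<in> arcs G"
  shows "tail G d \<in> verts G" "head G d \<in> verts G" "rev G d \<in> arcs G" "rev G (rev G d) = d"
    "rev G d \<noteq> d" "tail G (rev G d) = head G d" "head G (rev G d) = tail G d"
proof -
  show *: "rev G d \<in> arcs G" "rev G (rev G d) = d" "tail G (rev G d) = head G d"
    "tail G d \<in> verts G" "head G d \<in> verts G" "rev G d \<noteq> d"
    using assms unfolding multigraph_def by blast+
  have "tail G (rev G (rev G d)) = head G (rev G d)"
    using assms(1) *(1) unfolding multigraph_def by blast
  then show "head G (rev G d) = tail G d" using *(2) by simp
qed

lemma adj_symp: "multigraph G \<Longrightarrow> symp (adj G)"
  unfolding adj_def by (rule sympI) (metis multigraphD(3,6,7))

lemma adj_verts: "\<lbrakk>multigraph G; adj G u v\<rbrakk> \<Longrightarrow> u \<in> verts G \<and> v \<in> verts G"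
  unfolding adj_def by (metis multigraphD(1,2))

lemma matchable_verts:
  assumes "matchable (adj G) A" "multigraph G"
  shows "A \<subseteq> verts G"
  using assms by induction (use adj_verts in fastforce)+

text \<open>Recovers the edges that \<open>matchable\<close> forgets, choosing one among parallel
  edges. \<open>M\<close> contains both orientations of each matching edge, so every vertex of
  \<open>A\<close> is the tail of exactly one dart of \<open>M\<close>.\<close>

lemma matchable_darts:
  assumes "matchable (adj G) A" "multigraph G"
  obtains M where "M \<subseteq> arcs G" "rev G ` M \<subseteq> M" "inj_on (tail G) M" "tail G ` M = A"
proof -
  from assms have "\<exists>M \<subseteq> arcs G. rev G ` M \<subseteq> M \<and> inj_on (tail G) M \<and> tail G ` M = A"
  proof induction
    case empty
    then show ?case by (intro exI[of _ "{}"]) simp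
  next
    case (add A a b)
    obtain M where M: "M \<subseteq> arcs G" "rev G ` M \<subseteq> M" "inj_on (tail G) M" "tail G ` M = A"
      using add.IH[OF add.prems] by blast
    obtain d where d: "d \<in> arcs G" "tail G d = a" "head G d = b"
      using add.hyps(2) unfolding adj_def by blast
    note rd = multigraphD[OF add.prems d(1)]
    let ?M = "insert d (insert (rev G d) M)"
    have "?M \<subseteq> arcs G" using M d rd by simp
    moreover have "rev G ` ?M \<subseteq> ?M" using M rd by auto
    moreover have "inj_on (tail G) ?M"
      using M(3,4) add.hyps(3-5) d rd by auto
    moreover have "tail G ` ?M = insert a (insert b A)" using M d rd by simp
    ultimately show ?case by blast
  qed
  then show ?thesis using that by blast
qed

lemma vertex_transitive_regular:
  assumes "multigraph G" "vertex_transitive G" "u \<in> verts G" "v \<in> verts G"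
  shows "card (darts_at G u) = card (darts_at G v)"
proof -
  obtain fv fa where iso: "graph_iso_map G G fv fa" and uv: "fv u = v"
    using assms unfolding vertex_transitive_def by blast
  have inj: "inj_on fa (arcs G)" and onto: "fa ` arcs G = arcs G" and injv: "inj_on fv (verts G)"
    and tl: "\<And>d. d \<in> arcs G \<Longrightarrow> tail G (fa d) = fv (tail G d)"
    using iso unfolding graph_iso_map_def bij_betw_def by auto
  have im: "fa ` darts_at G u = darts_at G v"
  proof (intro equalityI subsetI)
    fix d assume "d \<in> fa ` darts_at G u"
    then show "d \<in> darts_at G v" using onto tl uv by auto
  next
    fix d assume d: "d \<in> darts_at G v"
    then obtain e where e: "e \<in> arcs G" "d = fa e" using onto by blast
    then have "fv (tail G e) = fv u" using tl[OF e(1)] d uv by simp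
    then have "tail G e = u"
      using injv assms(3) multigraphD(1)[OF assms(1) e(1)] by (auto dest: inj_onD)
    then show "d \<in> fa ` darts_at G u" using e by blast
  qed
  have "inj_on fa (darts_at G u)" using inj by (rule inj_on_subset) blast
  from card_image[OF this] show ?thesis unfolding im by simp
qed

lemma graph_iso_map_adj:
  assumes "multigraph G" "graph_iso_map G G fv fa" "x \<in> verts G" "y \<in> verts G"
  shows "adj G (fv x) (fv y) \<longleftrightarrow> adj G x y"
proof
  have onto: "fa ` arcs G = arcs G" and injv: "inj_on fv (verts G)"
    and th: "\<And>d. d \<in> arcs G \<Longrightarrow> tail G (fa d) = fv (tail G d) \<and> head G (fa d) = fv (head G d)"
    using assms unfolding graph_iso_map_def bij_betw_def by auto
  show "adj G (fv x) (fv y)" if "adj G x y"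
  proof -
    obtain d where d: "d \<in> arcs G" "tail G d = x" "head G d = y"
      using \<open>adj G x y\<close> unfolding adj_def by blast
    then have "fa d \<in> arcs G" using onto by (metis imageI)
    then show ?thesis unfolding adj_def using th[OF d(1)] d by (intro bexI[of _ "fa d"]) simp_all
  qed
  assume "adj G (fv x) (fv y)"
  then obtain d where d: "d \<in> arcs G" "tail G d = fv x" "head G d = fv y"
    unfolding adj_def by blast
  then obtain e where e: "e \<in> arcs G" "d = fa e" using onto by (metis imageE)
  have "fv (tail G e) = fv x" "fv (head G e) = fv y" using d e th by auto
  then have "tail G e = x" "head G e = y"
    using inj_onD[OF injv] multigraphD(1,2)[OF assms(1) e(1)] assms(3,4) by metis+
  then show "adj G x y" unfolding adj_def using e(1) by blast
qed

lemma finite_set_coverable: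
  assumes G: "multigraph G" and conn: "connected_graph G" and trans: "vertex_transitive G"
    and lf: "locally_finite G" and odd: "\<And>v. v \<in> verts G \<Longrightarrow> odd (card (darts_at G v))"
    and F: "finite F" "F \<subseteq> verts G"
  shows "\<exists>A. matchable (adj G) A \<and> F \<subseteq> A"
proof (rule ccontr)
  assume "\<not> ?thesis"
  then obtain C where CF: "C \<subseteq> F" and C: "matching_circuit (adj G) C"
    using matching_circuit_exists[OF F(1)] by metis
  obtain u where u: "u \<in> C"
    using matching_circuit_uncoverable[OF C matchable.empty] by blast
  have every: "\<exists>D. v \<in> D \<and> matching_circuit (adj G) D" if v: "v \<in> verts G" for v
  proof -
    have "u \<in> verts G" using u CF F(2) by blast
    then have "\<exists>fv fa. graph_iso_map G G fv fa \<and> fv u = v"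
      using v trans unfolding vertex_transitive_def by simp
    then obtain fv fa where iso: "graph_iso_map G G fv fa" and uv: "fv u = v"
      by (elim exE conjE)
    have "matching_circuit (adj G) (fv ` C)"
    proof (rule matching_circuit_image[OF _ _ _ C])
      show "bij_betw fv (verts G) (verts G)" using iso unfolding graph_iso_map_def by blast
      show "adj G (fv x) (fv y) \<longleftrightarrow> adj G x y" if "x \<in> verts G" "y \<in> verts G" for x y
        by (rule graph_iso_map_adj[OF G iso that])
      show "x \<in> verts G \<and> y \<in> verts G" if "adj G x y" for x y
        by (rule adj_verts[OF G that])
    qed (use CF F in blast)
    moreover have "v \<in> fv ` C" using u uv by blast
    ultimately show ?thesis by (intro exI[of _ "fv ` C"]) simp
  qed
  have "v \<in> C" if "(u, v) \<in> {(tail G d, head G d) | d. d \<in> arcs G}\<^sup>*" for v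
    using that
  proof induction
    case (step x y)
    then have xy: "adj G x y" unfolding adj_def by blast
    then have "y \<in> verts G" using adj_verts[OF G] by blast
    from every[OF this] obtain D where D: "y \<in> D" "matching_circuit (adj G) D" by (elim exE conjE)
    show ?case
      using matching_circuit_closed[OF adj_symp[OF G] C D(2) step.IH xy _ D(1)] step.IH by metis
  qed (rule u)
  then have CV: "C = verts G"
    using conn u CF F(2) unfolding connected_graph_def by blast
  then have fin: "finite (verts G)" using CF F(1) finite_subset by blast
  obtain A where A: "matchable (adj G) A" "C - {u} \<subseteq> A"
    by (rule matching_circuit_cover_minus[OF C u])
  have "u \<notin> A" using matching_circuit_uncoverable[OF C A(1)] A(2) by blast
  \<comment> \<open>The matching misses exactly one vertex of the graph, which makes the number of
    vertices odd.\<close>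
  then have "A = verts G - {u}" using A(2) CV matchable_verts[OF A(1) G] by blast
  then have "even (card (verts G) - 1)" using matchable_even[OF A(1)] u CV by simp
  moreover have "card (verts G) > 0" using fin u CV card_gt_0_iff by blast
  ultimately have oddV: "odd (card (verts G))" by simp
  \<comment> \<open>Handshake count over darts, a loop counting twice at its vertex: odd order times
    odd degree is odd, while \<open>rev\<close> pairs off all darts.\<close>
  have "card (arcs G) = card (\<Union>v\<in>verts G. darts_at G v)"
    using multigraphD(1)[OF G] by (intro arg_cong[of _ _ card]) auto
  also have "\<dots> = (\<Sum>v\<in>verts G. card (darts_at G v))"
    using lf fin unfolding locally_finite_def by (intro card_UN_disjoint) auto
  also have "\<dots> = (\<Sum>v\<in>verts G. card (darts_at G u))"
  proof (rule sum.cong)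
    show "card (darts_at G v) = card (darts_at G u)" if "v \<in> verts G" for v
      using vertex_transitive_regular[OF G trans that, of u] u CV by simp
  qed simp
  also have "\<dots> = card (verts G) * card (darts_at G u)" by simp
  finally have "odd (card (arcs G))" using oddV odd u CV by simp
  moreover have "even (card (arcs G))"
  proof (rule even_card_fixpoint_free_involution[where r = "rev G"])
    show "finite (arcs G)" using \<open>odd (card (arcs G))\<close> by (metis card.infinite even_zero)
    show "rev G d \<in> arcs G \<and> rev G (rev G d) = d \<and> rev G d \<noteq> d" if "d \<in> arcs G" for d
      using multigraphD[OF G that] by simp
  qed
  ultimately show False by blast
qed

section \<open>Labelling the darts\<close>

text \<open>The condition at a dart concerns only its reverse and the darts with the same tail, and
  reversal is tested only on edges with both ends in \<open>F\<close>; this makes it fit for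
  compactness. Only injectivity at a vertex is demanded: surjectivity onto the letters will follow
  by counting.\<close>

definition good_labelling ::
    "('v, 'd) mgraph \<Rightarrow> nat set \<Rightarrow> nat set \<Rightarrow> 'v set \<Rightarrow> ('d \<Rightarrow> letter) \<Rightarrow> bool" where
  "good_labelling G U I F f \<longleftrightarrow> (\<forall>d\<in>arcs G. tail G d \<in> F \<longrightarrow>
     f d \<in> letters U I \<and> (\<forall>e\<in>arcs G. tail G e = tail G d \<longrightarrow> f e = f d \<longrightarrow> e = d) \<and>
     (head G d \<in> F \<longrightarrow> f (rev G d) = linv I (f d)))"

lemma good_labellingI:
  assumes "\<And>d. \<lbrakk>d \<in> arcs G; tail G d \<in> F\<rbrakk> \<Longrightarrow> f d \<in> letters U I"
    and "\<And>d e. \<lbrakk>d \<in> arcs G; e \<in> arcs G; tail G d \<in> F; tail G e = tail G d; f e = f d\<rbrakk> \<Longrightarrow> e = d"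
    and "\<And>d. \<lbrakk>d \<in> arcs G; tail G d \<in> F; head G d \<in> F\<rbrakk> \<Longrightarrow> f (rev G d) = linv I (f d)"
  shows "good_labelling G U I F f"
  using assms unfolding good_labelling_def by simp

lemma good_labellingD:
  assumes "good_labelling G U I F f" "d \<in> arcs G" "tail G d \<in> F"
  shows "f d \<in> letters U I"
    and "\<lbrakk>e \<in> arcs G; tail G e = tail G d; f e = f d\<rbrakk> \<Longrightarrow> e = d"
    and "head G d \<in> F \<Longrightarrow> f (rev G d) = linv I (f d)"
  using assms unfolding good_labelling_def by simp_all

text \<open>Petersen's 2-factor theorem, relative to a finite set of vertices: orient the edges so that
  every vertex of F has k darts of each direction, then edge-colour the resulting bipartite graph of
  out- and in-copies of the vertices. The vertices outside F impose no constraint.\<close>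

lemma even_local_labelling:
  assumes G: "multigraph G" and "finite F"
    and deg: "\<And>v. v \<in> F \<Longrightarrow> finite (darts_at G v) \<and> card (darts_at G v) = 2 * k"
  shows "\<exists>f. good_labelling G {..<k} {} F f"
proof -
  define D where "D = {d \<in> arcs G. tail G d \<in> F}"
  have "D = (\<Union>v\<in>F. darts_at G v)" by (auto simp: D_def)
  then have finD: "finite D" using \<open>finite F\<close> deg by simp
  note [simp] = multigraphD[OF G]
  have Da: "d \<in> arcs G" "tail G d \<in> F" if "d \<in> D" for d using that by (auto simp: D_def)
  have "\<forall>v\<in>F. \<exists>h. bij_betw h (darts_at G v) {0..<2 * k}"
  proof
    fix v assume "v \<in> F"
    from deg[OF this] show "\<exists>h. bij_betw h (darts_at G v) {0..<2 * k}"
      using ex_bij_betw_finite_nat[of "darts_at G v"] by simp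
  qed
  from bchoice[OF this] obtain h
    where h: "\<And>v. v \<in> F \<Longrightarrow> bij_betw (h v) (darts_at G v) {0..<2 * k}" by blast
  \<comment> \<open>\<open>p\<close> groups the \<open>2 * k\<close> darts at each vertex of
    \<open>F\<close> into \<open>k\<close> pairs, in an arbitrary order, and \<open>q\<close> pairs
    the two orientations of an edge. A proper 2-colouring thus orients every edge within
    \<open>F\<close> and makes half of the darts at each vertex outgoing.\<close>
  define p where "p d = (tail G d, h (tail G d) d div 2)" for d
  define q where "q d = {d, rev G d}" for d
  have div2: "i = j \<or> j = l \<or> i = l" if "i div 2 = j div 2" "j div 2 = l div 2" for i j l :: nat
  proof -
    have "m = 2 * (m div 2) \<or> m = Suc (2 * (m div 2))" for m :: nat by presburger
    then show ?thesis using that by metis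
  qed
  have "\<exists>c :: 'b \<Rightarrow> bool. proper_colouring p q D c"
  proof (rule two_colouring[OF finD])
    fix x y z assume *: "x \<in> D" "y \<in> D" "z \<in> D" "p x = p y" "p y = p z"
    define v where "v = tail G x"
    have v: "v \<in> F" "x \<in> darts_at G v" "y \<in> darts_at G v" "z \<in> darts_at G v"
      using * Da by (auto simp: p_def v_def)
    have "h v x div 2 = h v y div 2" "h v y div 2 = h v z div 2"
      using * v by (auto simp: p_def)
    then have "h v x = h v y \<or> h v y = h v z \<or> h v x = h v z" by (rule div2)
    moreover note inj = inj_onD[OF bij_betw_imp_inj_on[OF h[OF v(1)]]]
    ultimately show "x = y \<or> y = z \<or> x = z"
      using inj[OF _ v(2,3)] inj[OF _ v(3,4)] inj[OF _ v(2,4)] by fast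
  next
    fix x y z assume *: "x \<in> D" "y \<in> D" "z \<in> D" "q x = q y" "q y = q z"
    then have "y \<in> {x, rev G x}" "z \<in> {x, rev G x}" by (auto simp: q_def)
    then show "x = y \<or> y = z \<or> x = z" by blast
  qed
  then obtain c :: "'b \<Rightarrow> bool" where c: "proper_colouring p q D c" by (elim exE)
  have c_rev: "c (rev G d) \<longleftrightarrow> \<not> c d" if "d \<in> D" "rev G d \<in> D" for d
  proof -
    have "d \<noteq> rev G d" using multigraphD(5)[OF G Da(1)[OF that(1)]] by simp
    moreover have "q d = q (rev G d)" using Da[OF that(1)] by (auto simp: q_def)
    ultimately show ?thesis using proper_colouringD[OF c that] by simp
  qed
  have fin_half: "finite {d \<in> darts_at G v. c d = b}" if v: "v \<in> F" for v b
    by (rule finite_subset[OF _ conjunct1[OF deg[OF v]]]) blast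
  have half: "card {d \<in> darts_at G v. c d = b} \<le> k" if v: "v \<in> F" for v b
  proof -
    have "inj_on (\<lambda>d. h v d div 2) {d \<in> darts_at G v. c d = b}"
    proof (rule inj_onI)
      fix x y
      assume *: "x \<in> {d \<in> darts_at G v. c d = b}" "y \<in> {d \<in> darts_at G v. c d = b}"
        "h v x div 2 = h v y div 2"
      then have "x \<in> D" "y \<in> D" "p x = p y" "c x = c y" using v by (auto simp: D_def p_def)
      then show "x = y" using proper_colouringD[OF c] by metis
    qed
    moreover have "(\<lambda>d. h v d div 2) ` {d \<in> darts_at G v. c d = b} \<subseteq> {..<k}"
    proof
      fix j assume "j \<in> (\<lambda>d. h v d div 2) ` {d \<in> darts_at G v. c d = b}"
      then obtain d where d: "d \<in> darts_at G v" "j = h v d div 2" by blast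
      have "h v d < 2 * k" using bij_betwE[OF h[OF v]] d(1) by fastforce
      then show "j \<in> {..<k}" using d(2) by simp
    qed
    ultimately show ?thesis using card_inj_on_le[of _ _ "{..<k}"] by fastforce
  qed
  \<comment> \<open>One dart for each edge that meets \<open>F\<close>, pointing in the chosen
    direction.\<close>
  define W where "W = {d \<in> D. c d} \<union> rev G ` {d \<in> D. \<not> c d}"
  have finW: "finite W" using finD by (simp add: W_def)
  have Wa: "x \<in> arcs G" if "x \<in> W" for x using that Da by (auto simp: W_def)
  have Wtail: "x \<in> D \<and> c x" if "x \<in> W" "tail G x \<in> F" for x
  proof -
    have xD: "x \<in> D" using Wa that by (simp add: D_def)
    moreover have "c x" if "x = rev G d" "d \<in> D" "\<not> c d" for d
      using that xD c_rev by simp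
    ultimately show ?thesis using that(1) by (auto simp: W_def)
  qed
  have Whead: "rev G x \<in> D \<and> \<not> c (rev G x)" if "x \<in> W" "head G x \<in> F" for x
  proof -
    have rD: "rev G x \<in> D" using Wa that by (simp add: D_def)
    moreover have "\<not> c (rev G x)" if "x \<in> D" "c x" using that rD c_rev by simp
    moreover have "\<not> c (rev G x)" if "x = rev G d" "d \<in> D" "\<not> c d" for d
      using that Da by simp
    ultimately show ?thesis using that(1) by (auto simp: W_def)
  qed
  have k_pos: "k \<ge> 1" if "x \<in> W" for x
  proof -
    obtain d where d: "d \<in> D" using \<open>x \<in> W\<close> by (auto simp: W_def)
    then have "d \<in> darts_at G (tail G d)" "tail G d \<in> F" using Da by auto
    then have "card (darts_at G (tail G d)) > 0" using deg card_gt_0_iff by blast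
    then show ?thesis using deg[OF \<open>tail G d \<in> F\<close>] by simp
  qed
  have one: "card {x \<in> W. P x} \<le> k" if "\<And>x. \<lbrakk>x \<in> W; P x\<rbrakk> \<Longrightarrow> x = y" for P y
  proof (cases "\<exists>x\<in>W. P x")
    case True
    then have "{x \<in> W. P x} \<subseteq> {y}" "k \<ge> 1" using that k_pos by blast+
    then show ?thesis using card_mono[of "{y}" "{x \<in> W. P x}"] by simp
  next
    case False
    then have "{x \<in> W. P x} = {}" by blast
    then show ?thesis by (simp only: card.empty)
  qed
  \<comment> \<open>Ends outside \<open>F\<close> carry no degree bound, so each dart gets a private
    vertex \<open>Inr x\<close> there. Its degree is one, which is at most \<open>k\<close> as soon
    as \<open>W\<close> is nonempty.\<close>
  define P where "P x = (if tail G x \<in> F then Inl (tail G x) else Inr x)" for x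
  define Q where "Q x = (if head G x \<in> F then Inl (head G x) else Inr x)" for x
  have "\<exists>C. C ` W \<subseteq> {..<k} \<and> proper_colouring P Q W C"
  proof (rule bipartite_edge_colouring[OF finW])
    fix v
    show "card {x \<in> W. P x = v} \<le> k"
    proof (cases v)
      case (Inl u)
      show ?thesis
      proof (cases "u \<in> F")
        case True
        have "{x \<in> W. P x = v} \<subseteq> {d \<in> darts_at G u. c d = True}"
          using Wtail Da Inl by (auto simp: P_def split: if_splits)
        then have "card {x \<in> W. P x = v} \<le> card {d \<in> darts_at G u. c d = True}"
          by (rule card_mono[OF fin_half[OF True]])
        then show ?thesis using half[OF True, of True] by linarith
      next
        case False
        then have "{x \<in> W. P x = v} = {}" using Inl by (auto simp: P_def split: if_splits)
        then show ?thesis by (simp only: card.empty)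
      qed
    next
      case (Inr y)
      show ?thesis by (rule one[of _ y]) (use Inr in \<open>auto simp: P_def split: if_splits\<close>)
    qed
    show "card {x \<in> W. Q x = v} \<le> k"
    proof (cases v)
      case (Inl u)
      show ?thesis
      proof (cases "u \<in> F")
        case True
        have "inj_on (rev G) {x \<in> W. Q x = v}"
        proof (rule inj_onI)
          fix x y assume "x \<in> {x \<in> W. Q x = v}" "y \<in> {x \<in> W. Q x = v}" "rev G x = rev G y"
          then have "rev G (rev G x) = rev G (rev G y)" "x \<in> arcs G" "y \<in> arcs G" using Wa by auto
          then show "x = y" by simp
        qed
        moreover have "rev G ` {x \<in> W. Q x = v} \<subseteq> {d \<in> darts_at G u. c d = False}"
          using Whead Wa Inl by (auto simp: Q_def split: if_splits)
        moreover note fin_half[OF True, of False]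
        ultimately have "card {x \<in> W. Q x = v} \<le> card {d \<in> darts_at G u. c d = False}"
          by (rule card_inj_on_le)
        then show ?thesis using half[OF True, of False] by linarith
      next
        case False
        then have "{x \<in> W. Q x = v} = {}" using Inl by (auto simp: Q_def split: if_splits)
        then show ?thesis by (simp only: card.empty)
      qed
    next
      case (Inr y)
      show ?thesis by (rule one[of _ y]) (use Inr in \<open>auto simp: Q_def split: if_splits\<close>)
    qed
  qed
  then obtain C where Ck: "C ` W \<subseteq> {..<k}" and C: "proper_colouring P Q W C" by (elim exE conjE)
  \<comment> \<open>The chosen direction of an edge carries a positive letter and the opposite
    direction its inverse, so each colour class becomes one generator in \<open>U\<close>.\<close>
  define f where "f d = (if c d then (C d, False) else (C (rev G d), True))" for d
  have W1: "d \<in> W" if "d \<in> D" "c d" for d using that by (simp add: W_def)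
  have W2: "rev G d \<in> W" if "d \<in> D" "\<not> c d" for d using that by (simp add: W_def)
  have "good_labelling G {..<k} {} F f"
  proof (rule good_labellingI)
    fix d assume "d \<in> arcs G" "tail G d \<in> F"
    then have "d \<in> D" by (simp add: D_def)
    then have "fst (f d) \<in> {..<k}" using W1 W2 Ck by (auto simp: f_def)
    then show "f d \<in> letters {..<k} {}" by (auto simp: letters_def case_prod_beta)
  next
    fix d e assume *: "d \<in> arcs G" "e \<in> arcs G" "tail G d \<in> F" "tail G e = tail G d" "f e = f d"
    then have D: "d \<in> D" "e \<in> D" by (simp_all add: D_def)
    have c_eq: "c e = c d" using *(5) by (auto simp: f_def split: if_splits)
    show "e = d"
    proof (cases "c d")
      case True
      then have "C e = C d" "P e = P d" using * c_eq by (auto simp: f_def P_def)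
      then show ?thesis using proper_colouringD[OF C W1 W1] D True c_eq by metis
    next
      case False
      then have "C (rev G e) = C (rev G d)" "Q (rev G e) = Q (rev G d)"
        using * c_eq by (auto simp: f_def Q_def)
      then have "rev G e = rev G d" using proper_colouringD[OF C W2 W2] D False c_eq by metis
      then have "rev G (rev G e) = rev G (rev G d)" by simp
      then show ?thesis using * by simp
    qed
  next
    fix d assume *: "d \<in> arcs G" "tail G d \<in> F" "head G d \<in> F"
    then have "d \<in> D" "rev G d \<in> D" by (simp_all add: D_def)
    then have "c (rev G d) \<longleftrightarrow> \<not> c d" by (rule c_rev)
    then show "f (rev G d) = linv {} (f d)" using * by (simp add: f_def linv_def)
  qed
  then show ?thesis by (rule exI[of _ f])
qed

text \<open>In odd degree, deleting a matching that covers \<open>F\<close> removes exactly one dart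
  at each vertex of \<open>F\<close>. The remaining graph may be disconnected and irregular off
  \<open>F\<close>, but the even case asks only for degrees on \<open>F\<close>.\<close>

lemma local_labelling:
  assumes G: "multigraph G" and conn: "connected_graph G" and trans: "vertex_transitive G"
    and lf: "locally_finite G" and deg: "\<And>v. v \<in> verts G \<Longrightarrow> card (darts_at G v) = n"
    and F: "finite F" "F \<subseteq> verts G"
  shows "\<exists>f. good_labelling G {..<n div 2} (if even n then {} else {n div 2}) F f"
proof (cases "even n")
  case True
  have "\<exists>f. good_labelling G {..<n div 2} {} F f"
    by (rule even_local_labelling[OF G F(1)]) (use deg F lf True in \<open>auto simp: locally_finite_def\<close>)
  then show ?thesis using True by simp
next
  case False
  let ?k = "n div 2"
  have "\<exists>A. matchable (adj G) A \<and> F \<subseteq> A"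
    by (rule finite_set_coverable[OF G conn trans lf _ F]) (use deg False in simp)
  then obtain A where A: "matchable (adj G) A" "F \<subseteq> A" by (elim exE conjE)
  obtain M where M: "M \<subseteq> arcs G" "rev G ` M \<subseteq> M" "inj_on (tail G) M" "tail G ` M = A"
    by (rule matchable_darts[OF A(1) G])
  have revM: "rev G d \<in> M \<longleftrightarrow> d \<in> M" if "d \<in> arcs G" for d
    using M(2) multigraphD(4)[OF G that] by (metis image_subset_iff)
  define H where "H = G\<lparr>arcs := arcs G - M\<rparr>"
  have H: "multigraph H"
    using G revM unfolding multigraph_def H_def by auto
  have "\<exists>f. good_labelling H {..<?k} {} F f"
  proof (rule even_local_labelling[OF H F(1)])
    fix v assume v: "v \<in> F"
    then obtain m where m: "m \<in> M" "tail G m = v" using M(4) A(2) by blast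
    have "darts_at H v = darts_at G v - {m}"
    proof (intro equalityI subsetI)
      fix d assume "d \<in> darts_at H v"
      then show "d \<in> darts_at G v - {m}" using m by (auto simp: H_def)
    next
      fix d assume d: "d \<in> darts_at G v - {m}"
      then have "d \<notin> M" using inj_onD[OF M(3), of d m] m by auto
      then show "d \<in> darts_at H v" using d by (auto simp: H_def)
    qed
    moreover have "m \<in> darts_at G v" using m M(1) by auto
    moreover have "finite (darts_at G v)" using lf v F(2) by (auto simp: locally_finite_def)
    moreover have "card (darts_at G v) = n" using deg v F(2) by blast
    ultimately show "finite (darts_at H v) \<and> card (darts_at H v) = 2 * ?k"
      using False by (simp add: card_Diff_singleton)
  qed
  then obtain f where f: "good_labelling H {..<?k} {} F f" by (elim exE)
  \<comment> \<open>\<open>?k\<close> is a fresh generator: at \<open>F\<close> the even part uses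
    only generators below \<open>?k\<close>, and on those \<open>linv {}\<close> and
    \<open>linv {?k}\<close> agree.\<close>
  define f' where "f' d = (if d \<in> M then (?k, False) else f d)" for d
  have Hd: "d \<in> arcs H" "tail H d = tail G d" "head H d = head G d" "rev H d = rev G d"
    if "d \<in> arcs G" "d \<notin> M" for d using that by (simp_all add: H_def)
  have fst_f: "fst (f d) < ?k" if "d \<in> arcs G" "d \<notin> M" "tail G d \<in> F" for d
  proof -
    have "f d \<in> letters {..<?k} {}"
      using good_labellingD(1)[OF f Hd(1)[OF that(1,2)]] Hd(2)[OF that(1,2)] that(3) by simp
    then show ?thesis by (auto simp: letters_def)
  qed
  have M_iff: "d \<in> M \<longleftrightarrow> fst (f' d) = ?k" if "d \<in> arcs G" "tail G d \<in> F" for d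
    using fst_f[OF that(1) _ that(2)] by (cases "d \<in> M") (simp_all add: f'_def)
  have "good_labelling G {..<?k} {?k} F f'"
  proof (rule good_labellingI)
    fix d assume *: "d \<in> arcs G" "tail G d \<in> F"
    show "f' d \<in> letters {..<?k} {?k}"
      using fst_f[of d] * by (cases "f d") (auto simp: f'_def letters_def)
  next
    fix d e assume *: "d \<in> arcs G" "e \<in> arcs G" "tail G d \<in> F" "tail G e = tail G d" "f' e = f' d"
    have iff: "e \<in> M \<longleftrightarrow> d \<in> M"
      using * M_iff by metis
    show "e = d"
    proof (cases "d \<in> M")
      case True
      then show ?thesis using inj_onD[OF M(3)] * iff by simp
    next
      case False
      then show ?thesis using good_labellingD(2)[OF f, of d e] * iff Hd by (simp add: f'_def)
    qed
  next
    fix d assume *: "d \<in> arcs G" "tail G d \<in> F" "head G d \<in> F"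
    show "f' (rev G d) = linv {?k} (f' d)"
    proof (cases "d \<in> M")
      case True
      then show ?thesis using revM[OF *(1)] by (simp add: f'_def linv_def)
    next
      case False
      then have "f (rev G d) = linv {} (f d)"
        using good_labellingD(3)[OF f, of d] * Hd[OF *(1)] by simp
      then show ?thesis using revM[OF *(1)] False fst_f[OF *(1) False *(2)]
        by (simp add: f'_def linv_def)
    qed
  qed
  then have "\<exists>f. good_labelling G {..<?k} {?k} F f" by (rule exI[of _ f'])
  then show ?thesis using False by simp
qed

lemma finite_letters: "\<lbrakk>finite U; finite I\<rbrakk> \<Longrightarrow> finite (letters U I)"
  by (rule finite_subset[of _ "(U \<union> I) \<times> UNIV"]) (auto simp: letters_def)

text \<open>For one dart the requirements involve finitely many darts, by local finiteness. The
  limit labelling agrees on them with \<open>h n\<close> for arbitrarily large \<open>n\<close>, in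
  particular for some \<open>n\<close> where \<open>F n\<close> contains both ends of the dart, and
  so inherits the requirements from \<open>h n\<close>.\<close>

lemma global_labelling:
  assumes G: "multigraph G" and lf: "locally_finite G" and "countable (verts G)"
    and UI: "finite U" "finite I"
    and loc: "\<And>F. \<lbrakk>finite F; F \<subseteq> verts G\<rbrakk> \<Longrightarrow> \<exists>f. good_labelling G U I F f"
  shows "\<exists>f. good_labelling G U I (verts G) f"
proof (cases "verts G = {}")
  case True
  then show ?thesis unfolding good_labelling_def by simp
next
  case False
  define F where "F n = from_nat_into (verts G) ` {..n}" for n :: nat
  have F: "finite (F n)" "F n \<subseteq> verts G" for n
    using from_nat_into[OF False] by (auto simp: F_def)
  obtain h where h: "good_labelling G U I (F n) (h n)" for n
    using loc[OF F] by metis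
  \<comment> \<open>Nothing is known about \<open>h n\<close> at darts starting outside
    \<open>F n\<close>; the default value keeps the range of \<open>g\<close> finite.\<close>
  define g where "g n d = (if tail G d \<in> F n then h n d else (0, False))" for n d
  have arcs_eq: "(\<Union>v\<in>verts G. darts_at G v) = arcs G" using multigraphD(1)[OF G] by auto
  have "countable (darts_at G v)" if "v \<in> verts G" for v
    using lf that by (auto simp: locally_finite_def intro: countable_finite)
  then have cnt: "countable (arcs G)"
    using countable_UN[OF \<open>countable (verts G)\<close>, of "darts_at G"] unfolding arcs_eq by blast
  have fin: "finite (insert (0, False) (letters U I))" using finite_letters[OF UI] by simp
  have gL: "g n d \<in> insert (0, False) (letters U I)" if "d \<in> arcs G" for n d
    using good_labellingD(1)[OF h] that by (auto simp: g_def)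
  have "\<exists>f. \<forall>B. finite B \<longrightarrow> B \<subseteq> arcs G \<longrightarrow> infinite {n. \<forall>d\<in>B. g n d = f d}"
    by (rule countable_compactness[OF cnt fin gL])
  then obtain f where "\<forall>B. finite B \<longrightarrow> B \<subseteq> arcs G \<longrightarrow> infinite {n. \<forall>d\<in>B. g n d = f d}"
    by (elim exE)
  then have f: "infinite {n. \<forall>d\<in>B. g n d = f d}" if "finite B" "B \<subseteq> arcs G" for B
    using that by simp
  have agree: "\<exists>n. tail G d \<in> F n \<and> head G d \<in> F n \<and> f (rev G d) = h n (rev G d) \<and>
      (\<forall>e\<in>darts_at G (tail G d). f e = h n e)" if d: "d \<in> arcs G" for d
  proof -
    let ?B = "insert (rev G d) (darts_at G (tail G d))"
    note md = multigraphD[OF G d]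
    define N where "N = max (to_nat_on (verts G) (tail G d)) (to_nat_on (verts G) (head G d))"
    have "infinite {n. \<forall>e\<in>?B. g n e = f e}"
      using lf md by (intro f) (auto simp: locally_finite_def)
    then obtain n where n: "n > N" "\<forall>e\<in>?B. g n e = f e"
      unfolding infinite_nat_iff_unbounded by blast
    have "v \<in> F n" if "v \<in> verts G" "to_nat_on (verts G) v \<le> n" for v
      using that \<open>countable (verts G)\<close> unfolding F_def
      by (intro image_eqI[of _ _ "to_nat_on (verts G) v"]) auto
    then have th: "tail G d \<in> F n" "head G d \<in> F n" using n(1) md unfolding N_def by auto
    then show ?thesis using n(2) md by (intro exI[of _ n]) (auto simp: g_def)
  qed
  have "good_labelling G U I (verts G) f"
  proof (rule good_labellingI)
    fix d assume d: "d \<in> arcs G"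
    obtain n where n: "tail G d \<in> F n" "head G d \<in> F n" "f (rev G d) = h n (rev G d)"
      "\<And>e. \<lbrakk>e \<in> arcs G; tail G e = tail G d\<rbrakk> \<Longrightarrow> f e = h n e"
      using agree[OF d] by auto
    note hn = good_labellingD[OF h d n(1)]
    show "f d \<in> letters U I" using hn(1) n(4)[OF d] by simp
    show "e = d" if "e \<in> arcs G" "tail G e = tail G d" "f e = f d" for e
      using hn(2)[of e] n(4)[of e] n(4)[OF d] that by simp
    show "f (rev G d) = linv I (f d)" using hn(3) n(2,3) n(4)[OF d] by simp
  qed
  then show ?thesis by (rule exI[of _ f])
qed

section \<open>The presentation of a labelled graph\<close>

text \<open>Together, \<open>lab\<close> and \<open>onto\<close> give each vertex exactly one
  outgoing dart per letter, as in a presentation graph.\<close>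

locale labelled_graph =
  fixes G :: "('v, 'd) mgraph" and U I :: "nat set" and f :: "'d \<Rightarrow> letter"
  assumes G: "multigraph G" and conn: "connected_graph G" and cnt: "countable (verts G)"
    and UI: "U \<inter> I = {}"
    and lab: "good_labelling G U I (verts G) f"
    and onto: "\<And>v. v \<in> verts G \<Longrightarrow> f ` darts_at G v = letters U I"
begin

abbreviation L :: "letter set" where "L \<equiv> letters U I"

lemma linv_letters: "l \<in> L \<Longrightarrow> linv I l \<in> L"
  by (auto simp: letters_def linv_def)

lemma label_letters: "d \<in> arcs G \<Longrightarrow> f d \<in> L"
  by (rule good_labellingD(1)[OF lab _ multigraphD(1)[OF G]])

lemma label_rev: "d \<in> arcs G \<Longrightarrow> f (rev G d) = linv I (f d)"
  by (rule good_labellingD(3)[OF lab _ multigraphD(1,2)[OF G]])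

lemma label_inj: "\<lbrakk>d \<in> arcs G; e \<in> arcs G; tail G d = tail G e; f d = f e\<rbrakk> \<Longrightarrow> d = e"
  by (rule good_labellingD(2)[OF lab _ multigraphD(1)[OF G]])

definition dart :: "'v \<Rightarrow> letter \<Rightarrow> 'd" where
  "dart v l = (SOME d. d \<in> arcs G \<and> tail G d = v \<and> f d = l)"

definition nxt :: "letter \<Rightarrow> 'v \<Rightarrow> 'v" where
  "nxt l v = head G (dart v l)"

lemma dart:
  assumes "v \<in> verts G" "l \<in> L"
  shows "dart v l \<in> arcs G" "tail G (dart v l) = v" "f (dart v l) = l"
proof -
  have "l \<in> f ` darts_at G v" using assms onto by simp
  then have "\<exists>d. d \<in> arcs G \<and> tail G d = v \<and> f d = l" by blast
  from someI_ex[OF this] show "dart v l \<in> arcs G" "tail G (dart v l) = v" "f (dart v l) = l"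
    unfolding dart_def by simp_all
qed

lemma dart_eq: "d \<in> arcs G \<Longrightarrow> dart (tail G d) (f d) = d"
  using dart[of "tail G d" "f d"] multigraphD(1)[OF G] label_letters label_inj by simp

lemma nxt_label: "d \<in> arcs G \<Longrightarrow> nxt (f d) (tail G d) = head G d"
  by (simp add: nxt_def dart_eq)

lemma nxt_verts: "\<lbrakk>v \<in> verts G; l \<in> L\<rbrakk> \<Longrightarrow> nxt l v \<in> verts G"
  unfolding nxt_def using dart(1) multigraphD(2)[OF G] by blast

lemma nxt_linv: "\<lbrakk>v \<in> verts G; l \<in> L\<rbrakk> \<Longrightarrow> nxt (linv I l) (nxt l v) = v"
  using nxt_label[of "rev G (dart v l)"] dart[of v l] multigraphD[OF G dart(1)[of v l]]
    label_rev[of "dart v l"] by (simp add: nxt_def)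

text \<open>A loop with a self-inverse label would have two orientations with the same tail and the
  same label. They would coincide, but \<open>rev\<close> fixes no dart.\<close>

lemma nxt_involutive_label_neq:
  assumes "v \<in> verts G" "s \<in> I"
  shows "nxt (s, False) v \<noteq> v"
proof
  assume eq: "nxt (s, False) v = v"
  have l: "(s, False) \<in> L" "linv I (s, False) = (s, False)"
    using assms by (simp_all add: letters_def linv_def)
  note d = dart[OF assms(1) l(1)]
  note rd = multigraphD[OF G d(1)]
  have "rev G (dart v (s, False)) = dart v (s, False)"
    using label_inj[OF rd(3) d(1)] rd(6) label_rev[OF d(1)] d eq l by (simp add: nxt_def)
  then show False using rd(5) by blast
qed

abbreviation walk :: "'v \<Rightarrow> letter list \<Rightarrow> 'v" where
  "walk v w \<equiv> fold nxt w v"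

lemma walk_verts: "\<lbrakk>v \<in> verts G; w \<in> lists L\<rbrakk> \<Longrightarrow> walk v w \<in> verts G"
  by (induction w arbitrary: v) (auto simp: nxt_verts)

lemma walk_reaches:
  assumes "u \<in> verts G" "v \<in> verts G"
  obtains w where "w \<in> lists L" "walk u w = v"
proof -
  have "(u, v) \<in> {(tail G d, head G d) | d. d \<in> arcs G}\<^sup>*"
    using conn assms unfolding connected_graph_def by blast
  then have "\<exists>w\<in>lists L. walk u w = v"
  proof induction
    case base
    show ?case by (rule bexI[of _ "[]"]) simp_all
  next
    case (step x y)
    then obtain w d where w: "w \<in> lists L" "walk u w = x"
      and d: "d \<in> arcs G" "tail G d = x" "head G d = y" by blast
    show ?case
      by (rule bexI[of _ "w @ [f d]"]) (use w d nxt_label[OF d(1)] label_letters in auto)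
  qed
  then show ?thesis using that by blast
qed

section \<open>The presentation, with vertices coded by natural numbers\<close>

definition num :: "'v \<Rightarrow> nat" where "num = to_nat_on (verts G)"

definition X :: "nat set" where "X = num ` verts G"

definition \<phi> :: "nat \<Rightarrow> nat \<Rightarrow> nat" where
  "\<phi> s x = num (nxt (s, False) (from_nat_into (verts G) x))"

definition R :: "nat \<Rightarrow> letter list set" where
  "R x = {w \<in> lists L. walk_end X \<phi> x w = x}"

lemma num_inj: "inj_on num (verts G)"
  unfolding num_def using cnt by (rule inj_on_to_nat_on)

lemma num_eq_iff: "\<lbrakk>u \<in> verts G; v \<in> verts G\<rbrakk> \<Longrightarrow> num u = num v \<longleftrightarrow> u = v"
  using num_inj by (rule inj_on_eq_iff)

lemma from_nat_into_num: "v \<in> verts G \<Longrightarrow> from_nat_into (verts G) (num v) = v"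
  unfolding num_def using cnt by simp

lemma \<phi>_num: "v \<in> verts G \<Longrightarrow> \<phi> s (num v) = num (nxt (s, False) v)"
  by (simp add: \<phi>_def from_nat_into_num)

lemma generator_letters: "s \<in> U \<union> I \<Longrightarrow> (s, False) \<in> L"
  by (auto simp: letters_def)

lemma \<phi>_bij:
  assumes "s \<in> U \<union> I"
  shows "bij_betw (\<phi> s) X X"
proof (rule bij_betw_byWitness[where f' = "\<lambda>x. num (nxt (linv I (s, False)) (from_nat_into (verts G) x))"])
  note s = generator_letters[OF assms]
  have s': "linv I (linv I (s, False)) = (s, False)" by (simp add: linv_def)
  note l = linv_letters[OF s]
  show "\<forall>x\<in>X. num (nxt (linv I (s, False)) (from_nat_into (verts G) (\<phi> s x))) = x"
  proof
    fix x assume "x \<in> X"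
    then obtain v where v: "v \<in> verts G" "x = num v" unfolding X_def by blast
    then show "num (nxt (linv I (s, False)) (from_nat_into (verts G) (\<phi> s x))) = x"
      using nxt_linv[OF v(1) s] nxt_verts[OF v(1) s] by (simp add: \<phi>_num from_nat_into_num)
  qed
  show "\<forall>x\<in>X. \<phi> s (num (nxt (linv I (s, False)) (from_nat_into (verts G) x))) = x"
  proof
    fix x assume "x \<in> X"
    then obtain v where v: "v \<in> verts G" "x = num v" unfolding X_def by blast
    then show "\<phi> s (num (nxt (linv I (s, False)) (from_nat_into (verts G) x))) = x"
      using nxt_linv[OF v(1) l] nxt_verts[OF v(1) l] s' by (simp add: \<phi>_num from_nat_into_num)
  qed
  show "\<phi> s ` X \<subseteq> X" using nxt_verts[OF _ s] by (auto simp: X_def \<phi>_num)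
  show "(\<lambda>x. num (nxt (linv I (s, False)) (from_nat_into (verts G) x))) ` X \<subseteq> X"
    using nxt_verts[OF _ l] by (auto simp: X_def from_nat_into_num)
qed

lemma act_num:
  assumes v: "v \<in> verts G" and l: "l \<in> L"
  shows "act X \<phi> l (num v) = num (nxt l v)"
proof (cases l)
  case (Pair s b)
  show ?thesis
  proof (cases b)
    case True
    \<comment> \<open>An inverse letter belongs to a generator in \<open>U\<close>, hence outside
      \<open>I\<close>, so \<open>linv\<close> really flips its sign.\<close>
    then have s: "s \<in> U" "linv I l = (s, False)" using l Pair UI by (auto simp: letters_def linv_def)
    have "the_inv_into X (\<phi> s) (num v) = num (nxt l v)"
    proof (rule the_inv_into_f_eq)
      show "inj_on (\<phi> s) X" using \<phi>_bij[of s] s by (simp add: bij_betw_def)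
      show "\<phi> s (num (nxt l v)) = num v"
        using nxt_linv[OF v l] nxt_verts[OF v l] s by (simp add: \<phi>_num)
      show "num (nxt l v) \<in> X" using nxt_verts[OF v l] by (simp add: X_def)
    qed
    then show ?thesis using Pair True by (simp add: act_def)
  qed (use Pair v in \<open>simp add: act_def \<phi>_num\<close>)
qed

lemma walk_end_num:
  "\<lbrakk>v \<in> verts G; w \<in> lists L\<rbrakk> \<Longrightarrow> walk_end X \<phi> (num v) w = num (walk v w)"
  unfolding walk_end_def by (induction w arbitrary: v) (auto simp: act_num nxt_verts)

lemma partite_pres_graph: "partite_pres X U I \<phi> R"
  unfolding partite_pres_def
proof (intro conjI ballI)
  show "X \<noteq> {}" using conn by (simp add: X_def connected_graph_def)
  show "U \<inter> I = {}" by (rule UI)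
  show "bij_betw (\<phi> s) X X" if "s \<in> U \<union> I" for s by (rule \<phi>_bij[OF that])
  fix x assume "x \<in> X"
  then obtain v where v: "v \<in> verts G" "x = num v" unfolding X_def by blast
  show "\<phi> s (\<phi> s x) = x" if "s \<in> I" for s
  proof -
    have "(s, False) \<in> L" "linv I (s, False) = (s, False)"
      using that by (simp_all add: letters_def linv_def)
    then show ?thesis using nxt_linv[of v "(s, False)"] nxt_verts v by (simp add: \<phi>_num)
  qed
  show "\<phi> s x \<noteq> x" if "s \<in> I" for s
    using nxt_involutive_label_neq[OF v(1) that] nxt_verts[OF v(1) generator_letters] that v
    by (simp add: \<phi>_num num_eq_iff)
  show "\<exists>w\<in>lists L. walk_end X \<phi> x w = y" if "y \<in> X" for y
  proof -
    obtain u where u: "u \<in> verts G" "y = num u" using \<open>y \<in> X\<close> unfolding X_def by blast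
    obtain w where "w \<in> lists L" "walk v w = u" by (rule walk_reaches[OF v(1) u(1)])
    then show ?thesis using walk_end_num[OF v(1)] u v by (intro bexI[of _ w]) simp_all
  qed
  show "r \<in> lists L" "walk_end X \<phi> x r = x" if "r \<in> R x" for r
    using that by (simp_all add: R_def)
qed

section \<open>Homotopy classes of walks and the isomorphism\<close>

definition base :: 'v where
  "base = (SOME v. v \<in> verts G \<and> num v = (SOME x. x \<in> X))"

lemma base: "base \<in> verts G" "num base = (SOME x. x \<in> X)"
proof -
  have "X \<noteq> {}" using conn by (simp add: X_def connected_graph_def)
  then have "(SOME x. x \<in> X) \<in> X" by (simp add: some_in_eq)
  then have "\<exists>v. v \<in> verts G \<and> num v = (SOME x. x \<in> X)" by (auto simp: X_def image_iff)
  from someI_ex[OF this] show "base \<in> verts G" "num base = (SOME x. x \<in> X)"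
    unfolding base_def by simp_all
qed

abbreviation H :: "(letter list \<times> letter list) set" where
  "H \<equiv> htpy X U I \<phi> R (SOME x. x \<in> X)"

lemma elem_htpy_walk:
  assumes "(w, w') \<in> elem_htpy X U I \<phi> R (SOME x. x \<in> X)"
  shows "w \<in> lists L" "w' \<in> lists L" "walk base w = walk base w'"
proof -
  consider (cancel) u l v where "w = u @ [l, linv I l] @ v" "w' = u @ v"
      "u \<in> lists L" "l \<in> L" "v \<in> lists L"
    | (relator) u r v where "w = u @ r @ v" "w' = u @ v" "u \<in> lists L" "v \<in> lists L"
      "r \<in> R (walk_end X \<phi> (num base) u)"
    using assms unfolding elem_htpy_def base(2) by blast
  then have "w \<in> lists L \<and> w' \<in> lists L \<and> walk base w = walk base w'"
  proof cases
    case cancel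
    then show ?thesis using nxt_linv walk_verts[OF base(1)] linv_letters by simp
  next
    case relator
    note u = walk_verts[OF base(1) relator(3)]
    have r: "r \<in> lists L" "walk_end X \<phi> (num (walk base u)) r = num (walk base u)"
      using relator walk_end_num[OF base(1)] by (simp_all add: R_def)
    then have "walk (walk base u) r = walk base u"
      using walk_end_num[OF u r(1)] num_eq_iff[OF walk_verts[OF u r(1)] u] by simp
    then show ?thesis using relator r by simp
  qed
  then show "w \<in> lists L" "w' \<in> lists L" "walk base w = walk base w'" by blast+
qed

lemma relator_elem_htpy:
  assumes "u \<in> lists L" "r \<in> lists L" "v \<in> lists L" "walk (walk base u) r = walk base u"
  shows "(u @ r @ v, u @ v) \<in> elem_htpy X U I \<phi> R (SOME x. x \<in> X)"
proof -
  have "r \<in> R (walk_end X \<phi> (num base) u)"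
    using assms walk_end_num[OF base(1)] walk_end_num[OF walk_verts[OF base(1)]]
    by (simp add: R_def)
  then show ?thesis using assms unfolding elem_htpy_def base(2) by blast
qed

text \<open>Elementary homotopies preserve endpoints. Conversely, all closed walks bound 2-cells, so
  the complex is simply connected and is its own universal cover.\<close>

lemma htpy_iff:
  assumes w: "w \<in> lists L"
  shows "(w, w') \<in> H \<longleftrightarrow> w' \<in> lists L \<and> walk base w' = walk base w"
proof
  assume "(w, w') \<in> H"
  then show "w' \<in> lists L \<and> walk base w' = walk base w"
    unfolding htpy_def
  proof induction
    case (step y z)
    then show ?case using elem_htpy_walk[of y z] elem_htpy_walk[of z y] by auto
  qed (use w in simp)
next
  assume w': "w' \<in> lists L \<and> walk base w' = walk base w"
  note we = walk_verts[OF base(1) w]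
  \<comment> \<open>w and w' are both obtained from w r w' by cutting out a closed walk.\<close>
  obtain r where r: "r \<in> lists L" "walk (walk base w) r = base"
    by (rule walk_reaches[OF we base(1)])
  let ?E = "elem_htpy X U I \<phi> R (SOME x. x \<in> X)"
  have "(w @ (r @ w') @ [], w @ []) \<in> ?E"
    by (rule relator_elem_htpy) (use w w' r in simp_all)
  moreover have "([] @ (w @ r) @ w', [] @ w') \<in> ?E"
    by (rule relator_elem_htpy) (use w w' r in simp_all)
  ultimately have "(w, w @ r @ w') \<in> ?E\<inverse>" "(w @ r @ w', w') \<in> ?E" by simp_all
  then show "(w, w') \<in> H"
    unfolding htpy_def by (meson UnCI r_into_rtrancl rtrancl.rtrancl_into_rtrancl)
qed

definition fibre :: "'v \<Rightarrow> letter list set" where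
  "fibre v = {w \<in> lists L. walk base w = v}"

lemma htpy_class: "w \<in> lists L \<Longrightarrow> H `` {w} = fibre (walk base w)"
  using htpy_iff[of w] by (auto simp: fibre_def)

lemma fibre_nonempty:
  assumes "v \<in> verts G"
  obtains w where "w \<in> lists L" "walk base w = v" "w \<in> fibre v"
  using walk_reaches[OF base(1) assms] unfolding fibre_def by blast

lemma fibre_bij: "bij_betw fibre (verts G) (lists L // H)"
proof (rule bij_betw_imageI)
  show "inj_on fibre (verts G)"
  proof (rule inj_onI)
    fix u v assume uv: "u \<in> verts G" "v \<in> verts G" "fibre u = fibre v"
    obtain w where w: "walk base w = u" "w \<in> fibre u" by (rule fibre_nonempty[OF uv(1)])
    then have "w \<in> fibre v" using uv(3) by simp
    then show "u = v" using w(1) by (simp add: fibre_def)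
  qed
  show "fibre ` verts G = lists L // H"
  proof (intro equalityI subsetI)
    fix c assume "c \<in> fibre ` verts G"
    then obtain v where v: "v \<in> verts G" "c = fibre v" by blast
    obtain w where w: "w \<in> lists L" "walk base w = v" by (rule fibre_nonempty[OF v(1)])
    then have "c = H `` {w}" using htpy_class v by simp
    then show "c \<in> lists L // H" using w(1) by (simp add: quotientI)
  next
    fix c assume "c \<in> lists L // H"
    then obtain w where w: "w \<in> lists L" "c = H `` {w}" by (rule quotientE)
    then have "c = fibre (walk base w)" using htpy_class by simp
    then show "c \<in> fibre ` verts G" using walk_verts[OF base(1) w(1)] by simp
  qed
qed

lemma fibre_step:
  assumes v: "v \<in> verts G" and l: "l \<in> L"
  shows "{w'. \<exists>w\<in>fibre v. (w @ [l], w') \<in> H} = fibre (nxt l v)"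
proof -
  have *: "(w @ [l], w') \<in> H \<longleftrightarrow> w' \<in> fibre (nxt l v)" if "w \<in> fibre v" for w w'
    using that l htpy_iff[of "w @ [l]" w'] by (simp add: fibre_def)
  obtain w where "w \<in> fibre v" by (rule fibre_nonempty[OF v])
  then show ?thesis using * by blast
qed

lemma graph_iso_pcay: "graph_iso G (pcay X U I \<phi> R)"
proof -
  let ?P = "pcay X U I \<phi> R"
  define fa where "fa d = (fibre (tail G d), f d)" for d
  have P: "verts ?P = lists L // H" "arcs ?P = (lists L // H) \<times> L" "tail ?P = fst"
    "head ?P = (\<lambda>(c, l). {w'. \<exists>w\<in>c. (w @ [l], w') \<in> H})"
    "rev ?P = (\<lambda>(c, l). ({w'. \<exists>w\<in>c. (w @ [l], w') \<in> H}, linv I l))"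
    by (simp_all add: pcay_def Let_def)
  have fib_inj: "inj_on fibre (verts G)" and fib_im: "fibre ` verts G = lists L // H"
    using fibre_bij by (simp_all add: bij_betw_def)
  have step: "{w'. \<exists>w\<in>fibre (tail G d). (w @ [f d], w') \<in> H} = fibre (head G d)"
    if "d \<in> arcs G" for d
    using fibre_step[OF multigraphD(1)[OF G that] label_letters[OF that]] nxt_label[OF that] by simp
  have "bij_betw fa (arcs G) (arcs ?P)"
  proof (rule bij_betw_imageI)
    show "inj_on fa (arcs G)"
    proof (rule inj_onI)
      fix d e assume de: "d \<in> arcs G" "e \<in> arcs G" "fa d = fa e"
      then have "tail G d = tail G e"
        using inj_onD[OF fib_inj] multigraphD(1)[OF G] by (simp add: fa_def)
      then show "d = e" using label_inj de by (simp add: fa_def)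
    qed
    show "fa ` arcs G = arcs ?P"
    proof (intro equalityI subsetI)
      fix x assume "x \<in> fa ` arcs G"
      then obtain d where d: "d \<in> arcs G" "x = fa d" by blast
      then show "x \<in> arcs ?P"
        using fib_im multigraphD(1)[OF G d(1)] label_letters by (auto simp: P fa_def)
    next
      fix x assume "x \<in> arcs ?P"
      then obtain c l where x: "x = (c, l)" "c \<in> lists L // H" "l \<in> L" unfolding P by blast
      then obtain v where v: "v \<in> verts G" "c = fibre v" using fib_im by (metis imageE)
      note d = dart[OF v(1) x(3)]
      show "x \<in> fa ` arcs G"
        by (rule image_eqI[OF _ d(1)]) (simp add: fa_def x v d)
    qed
  qed
  moreover have "tail ?P (fa d) = fibre (tail G d)" "head ?P (fa d) = fibre (head G d)"
    "fa (rev G d) = rev ?P (fa d)" if d: "d \<in> arcs G" for d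
    using step[OF d] label_rev[OF d] multigraphD(6)[OF G d] by (simp_all add: P fa_def)
  ultimately have "graph_iso_map G ?P fibre fa"
    using fibre_bij unfolding graph_iso_map_def P(1) by simp
  then show ?thesis unfolding graph_iso_def by blast
qed

end

section \<open>Counting letters, and conclusion\<close>

lemma card_letters_regular:
  "card (letters {..<n div 2} (if even n then {} else {n div 2})) = n"
proof -
  have "letters {..<n div 2} (if even n then {} else {n div 2}) =
      ({..<n div 2} \<times> UNIV) \<union> (if even n then {} else {(n div 2, False)})"
    by (auto simp: letters_def)
  also have "card \<dots> = n div 2 * 2 + (if even n then 0 else 1)"
    by (subst card_Un_disjoint) (auto simp: card_cartesian_product UNIV_bool)
  also have "\<dots> = n" by presburger
  finally show ?thesis .
qed

theorem theorem1p1: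
  fixes G :: "('v, 'd) mgraph"
  assumes "multigraph G"
    and "connected_graph G"
    and "countable (verts G)"
    and "vertex_transitive G"
    and "locally_finite G"
  shows "\<exists>(X :: nat set) (U :: nat set) (I :: nat set) (\<phi> :: nat \<Rightarrow> nat \<Rightarrow> nat)
            (R :: nat \<Rightarrow> letter list set).
            partite_pres X U I \<phi> R \<and> graph_iso G (pcay X U I \<phi> R)"
proof -
  obtain v\<^sub>0 where v\<^sub>0: "v\<^sub>0 \<in> verts G" using assms(2) unfolding connected_graph_def by blast
  define n where "n = card (darts_at G v\<^sub>0)"
  have deg: "card (darts_at G v) = n" if "v \<in> verts G" for v
    unfolding n_def by (rule vertex_transitive_regular[OF assms(1,4) that v\<^sub>0])
  define U where "U = {..<n div 2}"
  define I where "I = (if even n then {} else {n div 2})"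
  have fin: "finite U" "finite I" by (simp_all add: U_def I_def)
  have "\<exists>f. good_labelling G U I (verts G) f"
    by (rule global_labelling[OF assms(1,5,3) fin])
       (use local_labelling[OF assms(1,2,4,5) deg] in \<open>simp add: U_def I_def\<close>)
  then obtain f where f: "good_labelling G U I (verts G) f" by (elim exE)
  \<comment> \<open>There are as many letters as darts at a vertex, so an injective labelling there
    uses every letter.\<close>
  have onto: "f ` darts_at G v = letters U I" if v: "v \<in> verts G" for v
  proof (rule card_subset_eq[OF finite_letters[OF fin]])
    show "f ` darts_at G v \<subseteq> letters U I" using good_labellingD(1)[OF f] v by auto
    have "inj_on f (darts_at G v)"
      using good_labellingD(2)[OF f] v by (intro inj_onI) auto
    then show "card (f ` darts_at G v) = card (letters U I)"
      using deg[OF v] card_letters_regular[of n] by (simp add: card_image U_def I_def)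
  qed
  interpret labelled_graph G U I f
    using assms f onto by unfold_locales (auto simp: U_def I_def)
  show ?thesis using partite_pres_graph graph_iso_pcay by blast
qed

end
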